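(* Let $\mathbf{A}$ be a finite algebra and consider the conditions: (i) $\mathbf{A}$ has a Maltsev polynomial; (ii) $\mathbf{A}$ has a pointed cube polynomial; (iii) $\mathbf{A}$ is a spread of its type $\mathbf{2}$ minimal sets; (iv) $d_{\mathbf{A}}(n)\in O(n)$; (v) $d_{\mathbf{A}}(n)\notin 2^{\Omega(n)}$; (vi) no finite power $\mathbf{A}^n$ has a nontrivial strongly abelian homomorphic image. Then for every finite algebra the implications (i)$\Rightarrow$(iv), (i)$\Rightarrow$(ii)$\Rightarrow$(v), and (iii)$\Rightarrow$(iv)$\Rightarrow$(v)$\Rightarrow$(vi) hold. Moreover, each of the following non-implications is witnessed by a finite algebra (i.e. there is a finite algebra satisfying the first condition but not the second): (vi)$\not\Rightarrow$(v), (v)$\not\Rightarrow$(iv), (iv)$\not\Rightarrow$(iii), (iii)$\not\Rightarrow$(ii), (ii)$\not\Rightarrow$(iv), (iv)$\not\Rightarrow$(ii), and (i)$\not\Rightarrow$(iii).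
   Context: For an algebra $\mathbf{A}$, $d_{\mathbf{A}}(n)$ denotes the least size of a generating set of $\mathbf{A}^n$. Big Oh notation: $f\in O(g)$ if $|f(x)|\le M|g(x)|$ for some constants $M,N>0$ and all $x>N$; $f\in\Omega(g)$ if $|f(x)|\ge M|g(x)|$ for all $x>N$; $2^{\Omega(n)}$ is the class of functions of the form $2^{h(n)}$ with $h\in\Omega(n)$. A Maltsev polynomial is a polynomial $F(x,y,z)$ with $F(x,y,y)=x=F(y,y,x)$ identically. A term $F(x_1,\dots,x_m)$ is an $m$-ary, $p$-pointed, $k$-cube term for $\mathbf{A}$ if there is a $k\times m$ matrix $M$ whose entries are variables and $p$ distinct constant symbols (interpreted as elements of $A$), with every column of $M$ containing a symbol different from the variable $x$, such that $\mathbf{A}$ satisfies $F(M)\approx (x,\dots,x)^T$, meaning that $F$ applied to each row of $M$ equals $x$. A pointed cube polynomial of $\mathbf{A}$ is a pointed cube term of the expansion of $\mathbf{A}$ by all constants. A subset $S\subseteq A$ is a spread of a collection $\mathcal U$ of subsets of $A$ if $S=p(U_1,\dots,U_k)$ for some polynomial $p$ of $\mathbf{A}$ and some (not necessarily distinct) $U_1,\dots,U_k\in\mathcal U$. Minimal sets, their types, and strongly abelian algebras are in the sense of tame congruence theory (Hobby–McKenzie); "type $\mathbf{2}$ minimal sets" are the $\langle\alpha,\beta\rangle$-minimal sets for prime quotients $\alpha\prec\beta$ of the congruence lattice of type $\mathbf{2}$. *)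

theory Defs
  imports "HOL-Algebra.Module" "HOL-Library.Landau_Symbols"
begin

record ('a, 'f) alg =
  univ :: "'a set"
  sig  :: "'f set"
  ar   :: "'f \<Rightarrow> nat"
  opr  :: "'f \<Rightarrow> 'a list \<Rightarrow> 'a"

definition is_alg :: "('a, 'f) alg \<Rightarrow> bool" where
  "is_alg A \<longleftrightarrow> univ A \<noteq> {} \<and>
     (\<forall>f\<in>sig A. \<forall>xs. length xs = ar A f \<and> set xs \<subseteq> univ A \<longrightarrow> opr A f xs \<in> univ A)"

definition fin_alg :: "('a, 'f) alg \<Rightarrow> bool" where
  "fin_alg A \<longleftrightarrow> is_alg A \<and> finite (univ A)"

datatype ('f, 'c) ptrm = PV nat | PC 'c | PA 'f "('f, 'c) ptrm list"

fun peval :: "('a, 'f) alg \<Rightarrow> (nat \<Rightarrow> 'a) \<Rightarrow> ('f, 'a) ptrm \<Rightarrow> 'a" where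
  "peval A s (PV i) = s i"
| "peval A s (PC c) = c"
| "peval A s (PA f ts) = opr A f (map (peval A s) ts)"

fun pwf :: "('a, 'f) alg \<Rightarrow> nat \<Rightarrow> ('f, 'a) ptrm \<Rightarrow> bool" where
  "pwf A m (PV i) = (i < m)"
| "pwf A m (PC c) = (c \<in> univ A)"
| "pwf A m (PA f ts) = (f \<in> sig A \<and> length ts = ar A f \<and> (\<forall>t\<in>set ts. pwf A m t))"

fun noconst :: "('f, 'c) ptrm \<Rightarrow> bool" where
  "noconst (PV i) = True"
| "noconst (PC c) = False"
| "noconst (PA f ts) = (\<forall>t\<in>set ts. noconst t)"

definition is_term :: "('a, 'f) alg \<Rightarrow> nat \<Rightarrow> ('f, 'a) ptrm \<Rightarrow> bool" where
  "is_term A m t \<longleftrightarrow> pwf A m t \<and> noconst t"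

definition pol_app :: "('a, 'f) alg \<Rightarrow> ('f, 'a) ptrm \<Rightarrow> 'a list \<Rightarrow> 'a" where
  "pol_app A p xs = peval A (\<lambda>i. xs ! i) p"

definition tuples :: "'a set \<Rightarrow> nat \<Rightarrow> 'a list set" where
  "tuples U n = {xs. length xs = n \<and> set xs \<subseteq> U}"

definition pow :: "('a, 'f) alg \<Rightarrow> nat \<Rightarrow> ('a list, 'f) alg" where
  "pow A n = \<lparr> univ = tuples (univ A) n, sig = sig A, ar = ar A,
     opr = (\<lambda>f ts. map (\<lambda>i. opr A f (map (\<lambda>t. t ! i) ts)) [0..<n]) \<rparr>"

definition closed_in :: "('a, 'f) alg \<Rightarrow> 'a set \<Rightarrow> bool" where
  "closed_in B S \<longleftrightarrow>
     (\<forall>f\<in>sig B. \<forall>xs. length xs = ar B f \<and> set xs \<subseteq> S \<longrightarrow> opr B f xs \<in> S)"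

definition sg :: "('a, 'f) alg \<Rightarrow> 'a set \<Rightarrow> 'a set" where
  "sg B X = \<Inter> {S. X \<subseteq> S \<and> S \<subseteq> univ B \<and> closed_in B S}"

definition d_gen :: "('a, 'f) alg \<Rightarrow> nat \<Rightarrow> nat" where
  "d_gen A n = (LEAST k. \<exists>X. X \<subseteq> univ (pow A n) \<and> finite X \<and> card X = k
                          \<and> sg (pow A n) X = univ (pow A n))"

definition con :: "('a, 'f) alg \<Rightarrow> ('a \<times> 'a) set \<Rightarrow> bool" where
  "con A \<theta> \<longleftrightarrow> equiv (univ A) \<theta> \<and>
     (\<forall>f\<in>sig A. \<forall>xs ys. length xs = ar A f \<and> length ys = ar A f \<and>
         list_all2 (\<lambda>x y. (x, y) \<in> \<theta>) xs ys \<longrightarrow> (opr A f xs, opr A f ys) \<in> \<theta>)"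

text \<open>quotient algebra A/theta (the homomorphic images are, up to isomorphism, these)\<close>
definition quot :: "('a, 'f) alg \<Rightarrow> ('a \<times> 'a) set \<Rightarrow> ('a set, 'f) alg" where
  "quot A \<theta> = \<lparr> univ = univ A // \<theta>, sig = sig A, ar = ar A,
     opr = (\<lambda>f Cs. \<theta> `` {opr A f (map (\<lambda>C. SOME x. x \<in> C) Cs)}) \<rparr>"

text \<open>strongly abelian (Hobby--McKenzie, Def. 5.1): strong term condition\<close>
definition strongly_abelian :: "('a, 'f) alg \<Rightarrow> bool" where
  "strongly_abelian B \<longleftrightarrow>
     (\<forall>k m t. is_term B (k + m) t \<longrightarrow>
        (\<forall>a\<in>tuples (univ B) k. \<forall>b\<in>tuples (univ B) k. \<forall>c\<in>tuples (univ B) k.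
         \<forall>e\<in>tuples (univ B) m. \<forall>f\<in>tuples (univ B) m.
           pol_app B t (a @ e) = pol_app B t (b @ f) \<longrightarrow>
           pol_app B t (c @ e) = pol_app B t (c @ f)))"

definition prime_quot :: "('a, 'f) alg \<Rightarrow> ('a \<times> 'a) set \<Rightarrow> ('a \<times> 'a) set \<Rightarrow> bool" where
  "prime_quot A \<alpha> \<beta> \<longleftrightarrow> con A \<alpha> \<and> con A \<beta> \<and> \<alpha> \<subset> \<beta> \<and>
     \<not> (\<exists>\<gamma>. con A \<gamma> \<and> \<alpha> \<subset> \<gamma> \<and> \<gamma> \<subset> \<beta>)"

definition ms_cand :: "('a, 'f) alg \<Rightarrow> ('a \<times> 'a) set \<Rightarrow> ('a \<times> 'a) set \<Rightarrow> 'a set \<Rightarrow> bool" where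
  "ms_cand A \<alpha> \<beta> V \<longleftrightarrow> (\<exists>p. pwf A 1 p \<and> V = (\<lambda>x. pol_app A p [x]) ` univ A \<and>
      (\<exists>(a, b)\<in>\<beta>. (pol_app A p [a], pol_app A p [b]) \<notin> \<alpha>))"

definition min_set :: "('a, 'f) alg \<Rightarrow> ('a \<times> 'a) set \<Rightarrow> ('a \<times> 'a) set \<Rightarrow> 'a set \<Rightarrow> bool" where
  "min_set A \<alpha> \<beta> V \<longleftrightarrow> ms_cand A \<alpha> \<beta> V \<and> \<not> (\<exists>W. ms_cand A \<alpha> \<beta> W \<and> W \<subset> V)"

definition is_trace :: "('a \<times> 'a) set \<Rightarrow> ('a \<times> 'a) set \<Rightarrow> 'a set \<Rightarrow> 'a set \<Rightarrow> bool" where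
  "is_trace \<alpha> \<beta> V N \<longleftrightarrow> (\<exists>b\<in>V. N = V \<inter> \<beta> `` {b}) \<and> (\<exists>x\<in>N. \<exists>y\<in>N. (x, y) \<notin> \<alpha>)"

text \<open>The induced algebra A|_N / alpha|_N is polynomially equivalent to a vector space:
  there is a vector space V (over a field K) with universe N/alpha|_N whose polynomial
  (= affine) operations are exactly the polynomial operations of A|_N / alpha|_N,
  i.e. the operations induced by polynomials of A preserving N.\<close>
definition trace_type2 :: "('a, 'f) alg \<Rightarrow> ('a \<times> 'a) set \<Rightarrow> 'a set \<Rightarrow> bool" where
  "trace_type2 A \<alpha> N \<longleftrightarrow>
    (let cls = (\<lambda>x. \<alpha> `` {x} \<inter> N); Q = cls ` N in
     \<exists>(K :: nat ring) (W :: (nat, 'a set) module).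
       field K \<and> Module.module K W \<and> carrier W = Q \<and>
       (\<forall>n (g :: 'a set list \<Rightarrow> 'a set).
          (\<exists>p. pwf A n p \<and> (\<forall>xs\<in>tuples N n. pol_app A p xs \<in> N) \<and>
               (\<forall>xs\<in>tuples N n. g (map cls xs) = cls (pol_app A p xs)))
          \<longleftrightarrow>
          (\<exists>ks c. length ks = n \<and> set ks \<subseteq> carrier K \<and> c \<in> Q \<and>
               (\<forall>qs\<in>tuples Q n.
                  g qs = finsum W (\<lambda>i. (ks ! i) \<odot>\<^bsub>W\<^esub> (qs ! i)) {..<n} \<oplus>\<^bsub>W\<^esub> c))))"

definition typ2 :: "('a, 'f) alg \<Rightarrow> ('a \<times> 'a) set \<Rightarrow> ('a \<times> 'a) set \<Rightarrow> bool" where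
  "typ2 A \<alpha> \<beta> \<longleftrightarrow> (\<exists>V N. min_set A \<alpha> \<beta> V \<and> is_trace \<alpha> \<beta> V N \<and> trace_type2 A \<alpha> N)"

definition type2_minimal_sets :: "('a, 'f) alg \<Rightarrow> 'a set set" where
  "type2_minimal_sets A = {V. \<exists>\<alpha> \<beta>. prime_quot A \<alpha> \<beta> \<and> typ2 A \<alpha> \<beta> \<and> min_set A \<alpha> \<beta> V}"

definition spread_of :: "('a, 'f) alg \<Rightarrow> 'a set set \<Rightarrow> 'a set \<Rightarrow> bool" where
  "spread_of A \<U> S \<longleftrightarrow> (\<exists>k p Us. pwf A k p \<and> length Us = k \<and> set Us \<subseteq> \<U> \<and>
      S = {pol_app A p xs | xs. length xs = k \<and> (\<forall>i<k. xs ! i \<in> Us ! i)})"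

definition has_maltsev_poly :: "('a, 'f) alg \<Rightarrow> bool" where
  "has_maltsev_poly A \<longleftrightarrow> (\<exists>p. pwf A 3 p \<and>
     (\<forall>x\<in>univ A. \<forall>y\<in>univ A. pol_app A p [x, y, y] = x \<and> pol_app A p [y, y, x] = x))"

text \<open>matrix entries: variables (variable 0 plays the role of x) or constants from A\<close>
datatype 'a cell = CV nat | CC 'a

fun cell_val :: "(nat \<Rightarrow> 'a) \<Rightarrow> 'a cell \<Rightarrow> 'a" where
  "cell_val s (CV i) = s i"
| "cell_val s (CC c) = c"

definition has_pointed_cube_poly :: "('a, 'f) alg \<Rightarrow> bool" where
  "has_pointed_cube_poly A \<longleftrightarrow> (\<exists>m k p (M :: nat \<Rightarrow> nat \<Rightarrow> 'a cell).
     1 \<le> m \<and> 1 \<le> k \<and> pwf A m p \<and>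
     (\<forall>i<k. \<forall>j<m. \<forall>c. M i j = CC c \<longrightarrow> c \<in> univ A) \<and>
     (\<forall>j<m. \<exists>i<k. M i j \<noteq> CV 0) \<and>
     (\<forall>s. (\<forall>v. s v \<in> univ A) \<longrightarrow>
        (\<forall>i<k. pol_app A p (map (\<lambda>j. cell_val s (M i j)) [0..<m]) = s 0)))"

definition spread_of_type2 :: "('a, 'f) alg \<Rightarrow> bool" where
  "spread_of_type2 A \<longleftrightarrow> spread_of A (type2_minimal_sets A) (univ A)"

definition d_linear :: "('a, 'f) alg \<Rightarrow> bool" where
  "d_linear A \<longleftrightarrow> (\<lambda>n. real (d_gen A n)) \<in> O(\<lambda>n. real n)"

definition d_not_exp :: "('a, 'f) alg \<Rightarrow> bool" where
  "d_not_exp A \<longleftrightarrow> \<not> (\<exists>h :: nat \<Rightarrow> real. h \<in> \<Omega>(\<lambda>n. real n) \<and>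
      (\<forall>\<^sub>F n in at_top. real (d_gen A n) = 2 powr h n))"

definition no_sa_image :: "('a, 'f) alg \<Rightarrow> bool" where
  "no_sa_image A \<longleftrightarrow> (\<forall>n \<theta>. con (pow A n) \<theta> \<longrightarrow>
      \<not> ((\<exists>x\<in>univ (quot (pow A n) \<theta>). \<exists>y\<in>univ (quot (pow A n) \<theta>). x \<noteq> y)
          \<and> strongly_abelian (quot (pow A n) \<theta>)))"

end

(*
  Adding the constant tuples costs at most card (univ A) generators, so generation in powers may
  be done with polynomials.  If q(x, 0) = x = q(0, x) on U, then U^n is generated by the tuples
  with at most one nonzero entry.  A Maltsev polynomial F gives q(x, y) = F(x, 0, y) on the whole
  algebra.  On a type 2 minimal set q comes from the vector space addition of a trace: polynomials
  not collapsing the minimal set into alpha permute it, and composing with inverse permutations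
  corrects addition modulo alpha to an operation with an exact neutral element.

  For a k-cube polynomial d(N) <= k d(N - N div k + 1) + card (univ A), which is subexponential.

  A term operation of a strongly abelian algebra with q elements depends on at most q variables,
  so g elements generate at most (g + 1)^q q^(q^q) elements of a power; the n-th power has at
  least 2^n.

  In the counterexamples, lower bounds for d(n) come from tuples that every generating set has
  to contain because they are values of basic operations only if they are among the arguments.
*)
theory Submission
  imports Defs "HOL-Real_Asymp.Real_Asymp"
begin

text \<open>Both linear bounds come from one argument about spreads of sets that carry a unital
  polynomial; (i) is the case of the single set \<open>univ A\<close>. For (iii) the obstacle is
  that the vector space lives on the \<alpha>-classes of one trace of one minimal set, while a
  spread is built from whole minimal sets, and from any of them. Minimality bridges the gap: keeping
  a single pair of the trace apart modulo \<alpha> already forces bijectivity on the whole minimal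
  set, and any two minimal sets of the same prime quotient are matched by polynomial bijections.
  Inverses are again polynomials because some positive power of a permutation of a finite set is the
  identity.

  A cube polynomial gives no linear bound in general: each of the k smaller powers keeps the
  fraction 1 - 1/k of the coordinates, so the lengths add up to about (k - 1) N. For k = 2 this is
  N, in line with the Maltsev case; for k = 3 it is 2 N, and \<open>pointed_alg\<close> has at least
  quadratic growth.\<close>

lemma tuples_iff: "xs \<in> tuples U n \<longleftrightarrow> length xs = n \<and> (\<forall>i<n. xs ! i \<in> U)"
  by (auto simp: tuples_def set_conv_nth)

lemma finite_tuples: "finite U \<Longrightarrow> finite (tuples U n)"
  using finite_lists_length_eq[of U n] by (simp add: tuples_def conj_commute)

lemma card_tuples: "finite U \<Longrightarrow> card (tuples U n) = card U ^ n"
  using card_lists_length_eq[of U n] by (simp add: tuples_def conj_commute)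

lemma map_upt_tuples: "(\<And>i. i < n \<Longrightarrow> f i \<in> U) \<Longrightarrow> map f [0..<n] \<in> tuples U n"
  by (auto simp: tuples_iff)

lemma pow_sel [simp]:
  "univ (pow A n) = tuples (univ A) n" "sig (pow A n) = sig A" "ar (pow A n) = ar A"
  "opr (pow A n) f ts = map (\<lambda>i. opr A f (map (\<lambda>t. t ! i) ts)) [0..<n]"
  by (simp_all add: pow_def)

section \<open>Evaluation and substitution of polynomials\<close>

lemma peval_closed:
  assumes "is_alg A" "pwf A m p" "\<And>i. i < m \<Longrightarrow> s i \<in> univ A"
  shows "peval A s p \<in> univ A"
  using assms(2)
proof (induction p)
  case (PA f ts)
  then have "set (map (peval A s) ts) \<subseteq> univ A" by auto
  with PA.prems assms(1) show ?case by (auto simp: is_alg_def)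
qed (use assms in auto)

lemma peval_cong:
  assumes "pwf A m p" "\<And>i. i < m \<Longrightarrow> s i = s' i"
  shows "peval A s p = peval A s' p"
  using assms(1)
proof (induction p)
  case (PA f ts)
  then have "map (peval A s) ts = map (peval A s') ts" by auto
  then show ?case by (simp only: peval.simps)
qed (use assms in auto)

text \<open>Composition of polynomials on the level of syntax: the definitions quantify over
  \<open>ptrm\<close>, so every composed operation needs a \<open>ptrm\<close> that realizes
  it.\<close>

primrec psubst :: "(nat \<Rightarrow> ('f, 'c) ptrm) \<Rightarrow> ('f, 'c) ptrm \<Rightarrow> ('f, 'c) ptrm" where
  "psubst \<sigma> (PV i) = \<sigma> i"
| "psubst \<sigma> (PC c) = PC c"
| "psubst \<sigma> (PA f ts) = PA f (map (psubst \<sigma>) ts)"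

lemma peval_psubst: "peval A s (psubst \<sigma> p) = peval A (\<lambda>i. peval A s (\<sigma> i)) p"
  by (induction p) (auto simp: comp_def intro!: arg_cong[where f = "opr A f" for f])

lemma psubst_PV: "psubst PV p = p"
  by (induction p) (auto intro: map_idI)

lemma pwf_psubst: "pwf A m p \<Longrightarrow> (\<And>i. i < m \<Longrightarrow> pwf A n (\<sigma> i)) \<Longrightarrow> pwf A n (psubst \<sigma> p)"
  by (induction p) auto

lemma noconst_psubst:
  "noconst p \<Longrightarrow> (\<And>i. noconst (\<sigma> i)) \<Longrightarrow> noconst (psubst \<sigma> p)"
  by (induction p) auto

lemma is_alg_pow:
  assumes "is_alg A" shows "is_alg (pow A n)"
proof -
  obtain a where "a \<in> univ A" using assms by (auto simp: is_alg_def)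
  then have "replicate n a \<in> tuples (univ A) n" by (auto simp: tuples_def)
  moreover have "opr A f (map (\<lambda>t. t ! i) ts) \<in> univ A"
    if "f \<in> sig A" "length ts = ar A f" "set ts \<subseteq> tuples (univ A) n" "i < n" for f ts i
  proof -
    have "set (map (\<lambda>t. t ! i) ts) \<subseteq> univ A"
      using that(3,4) by (auto simp: tuples_iff)
    then show ?thesis using assms that(1,2) by (auto simp: is_alg_def)
  qed
  ultimately show ?thesis by (auto simp: is_alg_def intro!: map_upt_tuples)
qed

section \<open>Subalgebras of powers and bounds for \<open>d_gen\<close>\<close>

lemma closed_in_univ: "is_alg B \<Longrightarrow> closed_in B (univ B)"
  by (auto simp: closed_in_def is_alg_def)

lemma sg_subset_univ: "is_alg B \<Longrightarrow> X \<subseteq> univ B \<Longrightarrow> sg B X \<subseteq> univ B"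
  using closed_in_univ unfolding sg_def by blast

lemma sg_superset: "X \<subseteq> sg B X"
  unfolding sg_def by blast

lemma sg_least: "X \<subseteq> S \<Longrightarrow> S \<subseteq> univ B \<Longrightarrow> closed_in B S \<Longrightarrow> sg B X \<subseteq> S"
  unfolding sg_def by blast

lemma closed_in_sg: "closed_in B (sg B X)"
  unfolding closed_in_def sg_def by (auto 4 4 simp: le_Inf_iff)

lemma sg_induct:
  assumes "z \<in> sg B X" "is_alg B" "X \<subseteq> univ B"
    and "\<And>x. x \<in> X \<Longrightarrow> P x"
    and "\<And>f xs. f \<in> sig B \<Longrightarrow> length xs = ar B f \<Longrightarrow> set xs \<subseteq> univ B \<Longrightarrow>
           (\<And>x. x \<in> set xs \<Longrightarrow> P x) \<Longrightarrow> P (opr B f xs)"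
  shows "P z"
proof -
  have "closed_in B {x \<in> univ B. P x}"
    using assms(2,5) unfolding closed_in_def is_alg_def by (simp add: subset_iff)
  then have "sg B X \<subseteq> {x \<in> univ B. P x}"
    using assms(3,4) by (intro sg_least) auto
  then show ?thesis using assms(1) by auto
qed

text \<open>The finite power generates itself, so the minimum in \<open>d_gen\<close> is
  attained.\<close>

lemma generators_exist:
  assumes "fin_alg A"
  obtains X where "X \<subseteq> univ (pow A n)" "finite X" "card X = d_gen A n"
    "sg (pow A n) X = univ (pow A n)"
proof -
  let ?P = "\<lambda>k. \<exists>X. X \<subseteq> univ (pow A n) \<and> finite X \<and> card X = k
                          \<and> sg (pow A n) X = univ (pow A n)"
  have "is_alg (pow A n)" "finite (univ (pow A n))"
    using assms is_alg_pow finite_tuples by (auto simp: fin_alg_def)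
  then have "?P (card (univ (pow A n)))"
    using sg_subset_univ[of "pow A n" "univ (pow A n)"] sg_superset[of "univ (pow A n)" "pow A n"]
    by (intro exI[of _ "univ (pow A n)"]) (simp del: pow_sel add: subset_antisym)
  then have "?P (d_gen A n)"
    unfolding d_gen_def by (rule LeastI)
  then show ?thesis using that by blast
qed

lemma d_gen_le:
  assumes "X \<subseteq> univ (pow A n)" "finite X" "sg (pow A n) X = univ (pow A n)"
  shows "d_gen A n \<le> card X"
  unfolding d_gen_def by (rule Least_le) (use assms in blast)

lemma d_gen_le_span:
  assumes "fin_alg A" "X \<subseteq> tuples (univ A) n" "finite X"
    and "tuples (univ A) n \<subseteq> sg (pow A n) X"
  shows "d_gen A n \<le> card X"
  using assms sg_subset_univ[of "pow A n" X] is_alg_pow[of A n]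
  by (intro d_gen_le) (auto simp: fin_alg_def)

text \<open>Removing \<open>z\<close> from the universe leaves a subuniverse, so generators that
  avoid \<open>z\<close> never produce it.\<close>

lemma irreducible_in_generators:
  assumes "z \<in> univ B" "sg B X = univ B" "X \<subseteq> univ B" "is_alg B"
    and "\<And>f xs. f \<in> sig B \<Longrightarrow> length xs = ar B f \<Longrightarrow> set xs \<subseteq> univ B \<Longrightarrow>
           opr B f xs = z \<Longrightarrow> z \<in> set xs"
  shows "z \<in> X"
proof (rule ccontr)
  assume "z \<notin> X"
  have "closed_in B (univ B - {z})"
    using assms(4,5) unfolding closed_in_def is_alg_def by blast
  then have "sg B X \<subseteq> univ B - {z}"
    using assms(3) \<open>z \<notin> X\<close> by (intro sg_least) auto
  with assms(1,2) show False by auto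
qed

lemma d_gen_ge_card_irreducible:
  assumes "fin_alg A" "Z \<subseteq> tuples (univ A) n"
    and "\<And>z f xs. z \<in> Z \<Longrightarrow> f \<in> sig A \<Longrightarrow> length xs = ar A f \<Longrightarrow>
           set xs \<subseteq> tuples (univ A) n \<Longrightarrow> opr (pow A n) f xs = z \<Longrightarrow> z \<in> set xs"
  shows "card Z \<le> d_gen A n"
proof -
  obtain X where X: "X \<subseteq> univ (pow A n)" "finite X" "card X = d_gen A n"
    "sg (pow A n) X = univ (pow A n)"
    using generators_exist[OF assms(1)] by metis
  have "Z \<subseteq> X"
  proof
    fix z assume "z \<in> Z"
    show "z \<in> X"
      by (rule irreducible_in_generators[OF _ X(4,1)])
        (use assms \<open>z \<in> Z\<close> is_alg_pow in \<open>auto simp: fin_alg_def\<close>)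
  qed
  with X show ?thesis using card_mono by metis
qed

text \<open>Induction on \<open>p\<close>. A constant \<open>c\<close> acts in the power as the
  tuple \<open>replicate n c\<close>, which is why these tuples are required in
  \<open>S\<close>.\<close>

lemma closed_in_polynomial:
  assumes "closed_in (pow A n) S" "S \<subseteq> tuples (univ A) n"
    and "\<And>c. c \<in> univ A \<Longrightarrow> replicate n c \<in> S"
    and "pwf A m p" "\<And>i. i < m \<Longrightarrow> w i \<in> S"
  shows "map (\<lambda>j. peval A (\<lambda>i. w i ! j) p) [0..<n] \<in> S"
  using assms(4)
proof (induction p)
  case (PV i)
  then have "w i \<in> S" using assms(5) by simp
  moreover from this have "length (w i) = n" using assms(2) by (auto simp: tuples_def)
  ultimately show ?case using map_nth[of "w i"] by simp
next
  case (PC c)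
  then show ?case using assms(3)[of c] by (simp add: map_replicate_const)
next
  case (PA f ts)
  define us where "us = map (\<lambda>t. map (\<lambda>j. peval A (\<lambda>i. w i ! j) t) [0..<n]) ts"
  have "set us \<subseteq> S" using PA by (auto simp: us_def)
  moreover have "f \<in> sig A" "length us = ar A f" using PA.prems by (auto simp: us_def)
  ultimately have "opr (pow A n) f us \<in> S"
    using assms(1) by (simp add: closed_in_def)
  moreover have "opr (pow A n) f us = map (\<lambda>j. peval A (\<lambda>i. w i ! j) (PA f ts)) [0..<n]"
    by (auto simp: us_def comp_def intro!: arg_cong[where f = "opr A f"])
  ultimately show ?case by (simp only:)
qed

subsection \<open>Growth rates\<close>

text \<open>The Landau symbol only bounds \<open>\<bar>h n\<bar>\<close> from below, but \<open>h n\<close> cannot be negative because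
  \<open>d_gen A n\<close> is a natural number.\<close>
lemma d_not_exp_iff: "d_not_exp A \<longleftrightarrow> \<not> (\<exists>c>0. \<forall>\<^sub>F n in at_top. 2 powr (c * real n) \<le> real (d_gen A n))"
proof -
  have "(\<exists>h :: nat \<Rightarrow> real. h \<in> \<Omega>(\<lambda>n. real n) \<and>
      (\<forall>\<^sub>F n in at_top. real (d_gen A n) = 2 powr h n)) \<longleftrightarrow>
      (\<exists>c>0. \<forall>\<^sub>F n in at_top. 2 powr (c * real n) \<le> real (d_gen A n))" (is "?L \<longleftrightarrow> ?R")
  proof
    assume ?L
    then obtain h :: "nat \<Rightarrow> real" and c where c: "c > 0"
      "\<forall>\<^sub>F n in at_top. norm (h n) \<ge> c * norm (real n)"
      and h: "\<forall>\<^sub>F n in at_top. real (d_gen A n) = 2 powr h n"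
      by (auto elim!: landau_omega.bigE)
    have "\<forall>\<^sub>F n in at_top. 2 powr (c * real n) \<le> real (d_gen A n)"
      using c(2) h
    proof eventually_elim
      case (elim n)
      have "0 < real (d_gen A n)" using elim(2) by simp
      then have "1 \<le> real (d_gen A n)" by simp
      then have "1 \<le> 2 powr h n" using elim(2) by simp
      then have "h n \<ge> 0" by (metis ge_one_powr_ge_zero linorder_not_le powr_less_one one_less_numeral_iff semiring_norm(76) nle_le)
      then show ?case using elim by simp
    qed
    then show ?R using c by blast
  next
    assume ?R
    then obtain c where c: "c > 0" "\<forall>\<^sub>F n in at_top. 2 powr (c * real n) \<le> real (d_gen A n)"
      by blast
    define h where "h n = log 2 (real (d_gen A n))" for n
    have *: "\<forall>\<^sub>F n in at_top. c * real n \<le> h n \<and> real (d_gen A n) = 2 powr h n"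
      using c(2)
    proof eventually_elim
      case (elim n)
      then have "0 < real (d_gen A n)" by (smt (verit) powr_gt_zero)
      then show ?case using elim by (simp add: h_def le_log_iff)
    qed
    have "h \<in> \<Omega>(\<lambda>n. real n)"
      by (rule landau_omega.bigI[OF c(1)]) (use * in \<open>eventually_elim, auto\<close>)
    then show ?L using * by (auto elim: eventually_mono)
  qed
  then show ?thesis by (simp add: d_not_exp_def)
qed

text \<open>A lower bound of rate \<open>c\<close> is confronted with the upper bound of rate
  \<open>c / 2\<close>; the surplus factor \<open>2 powr (c / 2 * real n)\<close> outgrows any
  constant \<open>C\<close>.\<close>

lemma d_not_expI:
  assumes "\<And>c. c > 0 \<Longrightarrow> \<exists>C. \<forall>\<^sub>F n in at_top. real (d_gen A n) \<le> C * 2 powr (c * real n)"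
  shows "d_not_exp A"
proof -
  have False if c: "c > 0" "\<forall>\<^sub>F n in at_top. 2 powr (c * real n) \<le> real (d_gen A n)" for c
  proof -
    obtain C where C: "\<forall>\<^sub>F n in at_top. real (d_gen A n) \<le> C * 2 powr (c / 2 * real n)"
      using assms(1)[of "c / 2"] c(1) by auto
    have "filterlim (\<lambda>n. c / 2 * real n * ln 2) at_top at_top"
      using c(1) by real_asymp
    then have "filterlim (\<lambda>n. exp (c / 2 * real n * ln 2)) at_top at_top"
      by (rule filterlim_compose[OF exp_at_top])
    then have "\<forall>\<^sub>F n :: nat in at_top. exp (c / 2 * real n * ln 2) > C"
      by (simp add: filterlim_at_top_dense)
    then have "\<forall>\<^sub>F n :: nat in at_top. False"
      using c(2) C
    proof eventually_elim
      case (elim n)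
      define E where "E = 2 powr (c / 2 * real n)"
      have "2 powr (c * real n) = E * E"
        by (simp add: E_def flip: powr_add)
      moreover have "E > C" using elim(1) by (simp add: E_def powr_def)
      moreover have "E > 0" by (simp add: E_def)
      moreover have "E * E \<le> C * E" using elim(2,3) calculation(1) unfolding E_def by linarith
      ultimately show False by (meson linorder_not_le mult_less_cancel_right_pos)
    qed
    then show False by simp
  qed
  then show ?thesis unfolding d_not_exp_iff by blast
qed

lemma d_linear_imp_d_not_exp:
  assumes "d_linear A" shows "d_not_exp A"
proof (rule d_not_expI)
  fix c :: real assume "c > 0"
  then have "(\<lambda>n. real n) \<in> O(\<lambda>n. 2 powr (c * real n))"
    by real_asymp
  with assms have "(\<lambda>n. real (d_gen A n)) \<in> O(\<lambda>n. 2 powr (c * real n))"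
    unfolding d_linear_def by (rule landau_o.big_trans)
  then show "\<exists>C. \<forall>\<^sub>F n in at_top. real (d_gen A n) \<le> C * 2 powr (c * real n)"
    by (auto elim!: landau_o.bigE)
qed

lemma maltsev_imp_cube:
  assumes "has_maltsev_poly A" shows "has_pointed_cube_poly A"
proof -
  obtain p where p: "pwf A 3 p"
    "\<forall>x\<in>univ A. \<forall>y\<in>univ A. pol_app A p [x, y, y] = x \<and> pol_app A p [y, y, x] = x"
    using assms by (auto simp: has_maltsev_poly_def)
  \<comment> \<open>The rows are x, y, y and y, y, x with x = \<open>CV 0\<close> and y =
    \<open>CV 1\<close>: a 2-cube without constants.\<close>
  define M :: "nat \<Rightarrow> nat \<Rightarrow> 'a cell" where
    "M i j = (if i = j div 2 \<and> j \<noteq> 1 then CV 0 else CV 1)" for i j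
  have "M (if j = 0 then 1 else 0) j \<noteq> CV 0" for j
    by (auto simp: M_def)
  then have "\<forall>j<3. \<exists>i<2. M i j \<noteq> CV 0"
    by (metis one_less_numeral_iff pos2 semiring_norm(76))
  moreover have "pol_app A p (map (\<lambda>j. cell_val s (M i j)) [0..<3]) = s 0"
    if "\<forall>v. s v \<in> univ A" "i < 2" for s i
    using p(2) that by (auto simp: M_def upt_rec less_2_cases_iff)
  moreover have "\<forall>i j c. M i j \<noteq> CC c" by (simp add: M_def)
  ultimately show ?thesis
    unfolding has_pointed_cube_poly_def using p(1)
    by (intro exI[of _ 3] exI[of _ 2] exI[of _ p] exI[of _ M]) auto
qed

subsection \<open>Linear growth\<close>

text \<open>A two-sided neutral element \<open>z\<close>, with no demand that \<open>U\<close> be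
  closed under \<open>q\<close>: the spanning argument only applies \<open>q\<close> where at least
  one argument is \<open>z\<close>.\<close>

definition unital_poly :: "('a, 'f) alg \<Rightarrow> 'a set \<Rightarrow> bool" where
  "unital_poly A U \<longleftrightarrow> (\<exists>q. \<exists>z\<in>U. pwf A 2 q \<and>
     (\<forall>x\<in>U. pol_app A q [x, z] = x \<and> pol_app A q [z, x] = x))"

text \<open>The tuple \<open>u\<close> is assembled coordinate by coordinate: \<open>q\<close>
  combines its first \<open>k\<close> entries, padded with \<open>z\<close>, with the tuple that has
  \<open>u ! k\<close> in place \<open>k\<close> and \<open>z\<close> elsewhere. In every coordinate
  one argument is \<open>z\<close>, so the other one survives.\<close>

lemma unital_poly_span:
  assumes S: "closed_in (pow A n) S" "S \<subseteq> tuples (univ A) n"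
      "\<And>c. c \<in> univ A \<Longrightarrow> replicate n c \<in> S"
      "\<And>i a z. i < n \<Longrightarrow> a \<in> univ A \<Longrightarrow> z \<in> univ A \<Longrightarrow>
         map (\<lambda>j. if j = i then a else z) [0..<n] \<in> S"
    and "U \<subseteq> univ A" "unital_poly A U"
  shows "tuples U n \<subseteq> S"
proof
  fix u assume u: "u \<in> tuples U n"
  obtain q z where q: "z \<in> U" "pwf A 2 q"
    "\<And>x. x \<in> U \<Longrightarrow> pol_app A q [x, z] = x \<and> pol_app A q [z, x] = x"
    using assms(6) by (auto simp: unital_poly_def)
  have "map (\<lambda>j. if j < k then u ! j else z) [0..<n] \<in> S" if "k \<le> n" for k
    using that
  proof (induction k)
    case 0
    then show ?case using S(3)[of z] q(1) assms(5) by (auto simp: map_replicate_const)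
  next
    case (Suc k)
    define w where "w i = (if i = (0::nat) then map (\<lambda>j. if j < k then u ! j else z) [0..<n]
      else map (\<lambda>j. if j = k then u ! k else z) [0..<n])" for i
    have uk: "u ! j \<in> U" if "j < n" for j using u that by (auto simp: tuples_iff)
    have "w i \<in> S" for i
      using Suc S(4)[of k "u ! k" z] q(1) assms(5) uk[of k] by (auto simp: w_def)
    then have mem: "map (\<lambda>j. peval A (\<lambda>i. w i ! j) q) [0..<n] \<in> S"
      using closed_in_polynomial[OF S(1-3) q(2)] by blast
    have "peval A (\<lambda>i. w i ! j) q = (if j < Suc k then u ! j else z)" if "j < n" for j
    proof -
      have "peval A (\<lambda>i. w i ! j) q = pol_app A q [w 0 ! j, w 1 ! j]"
        unfolding pol_app_def
        by (rule peval_cong[OF q(2)]) (auto simp: less_2_cases_iff)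
      also have "\<dots> = (if j < Suc k then u ! j else z)"
        using q(1) q(3) uk[OF that] that by (auto simp: w_def less_Suc_eq)
      finally show ?thesis .
    qed
    then have "map (\<lambda>j. peval A (\<lambda>i. w i ! j) q) [0..<n] =
        map (\<lambda>j. if j < Suc k then u ! j else z) [0..<n]" by simp
    with mem show ?case by (simp only:)
  qed
  from this[of n] have "map (\<lambda>j. if j < n then u ! j else z) [0..<n] \<in> S" by simp
  moreover have "map (\<lambda>j. if j < n then u ! j else z) [0..<n] = u"
    using u by (auto simp: tuples_def intro: nth_equalityI)
  ultimately show "u \<in> S" by simp
qed

text \<open>Constant tuples and tuples with a single deviating entry span \<open>tuples U n\<close>
  for all \<open>U\<close> of the collection at once. Writing each coordinate of a tuple as a value
  of \<open>p\<close> then splits the tuple into one tuple over each \<open>Us ! i\<close>.\<close>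

lemma spread_unital_imp_d_linear:
  assumes "fin_alg A" "spread_of A \<U> (univ A)"
    and "\<And>U. U \<in> \<U> \<Longrightarrow> U \<subseteq> univ A \<and> unital_poly A U"
  shows "d_linear A"
proof -
  obtain k p Us where p: "pwf A k p" "length Us = k" "set Us \<subseteq> \<U>"
    and sp: "univ A = {pol_app A p xs | xs. length xs = k \<and> (\<forall>i<k. xs ! i \<in> Us ! i)}"
    using assms(2) by (auto simp: spread_of_def)
  define a where "a = card (univ A)"
  have fin: "finite (univ A)" "is_alg A" using assms(1) by (auto simp: fin_alg_def)
  have "d_gen A n \<le> a + n * a * a" for n
  proof -
    define X1 where "X1 = replicate n ` univ A"
    \<comment> \<open>All pairs of a deviating value and a background value are taken, since the
      neutral element depends on \<open>U\<close>.\<close>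
    define X2 where "X2 = (\<lambda>(i, a, z). map (\<lambda>j. if j = i then a else z) [0..<n]) `
      ({..<n} \<times> univ A \<times> univ A)"
    define X where "X = X1 \<union> X2"
    have X: "X \<subseteq> tuples (univ A) n" "finite X"
      using fin(1) by (auto simp: X_def X1_def X2_def tuples_def)
    have "card X \<le> card X1 + card X2" unfolding X_def by (rule card_Un_le)
    also have "card X1 \<le> a" unfolding X1_def a_def by (rule card_image_le[OF fin(1)])
    also have "card X2 \<le> card ({..<n} \<times> univ A \<times> univ A)"
      unfolding X2_def by (rule card_image_le) (use fin(1) in auto)
    also have "\<dots> = n * a * a" by (simp add: a_def card_cartesian_product)
    finally have card: "card X \<le> a + n * a * a" by simp
    define S where "S = sg (pow A n) X"
    have XS: "X \<subseteq> S" unfolding S_def by (rule sg_superset)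
    have S: "closed_in (pow A n) S" "S \<subseteq> tuples (univ A) n"
      using sg_subset_univ[OF is_alg_pow[OF fin(2)]] X(1) closed_in_sg by (auto simp: S_def)
    have S3: "replicate n c \<in> S" if "c \<in> univ A" for c
      using XS that by (auto simp: X_def X1_def)
    have S4: "map (\<lambda>j. if j = i then a else z) [0..<n] \<in> S"
      if "i < n" "a \<in> univ A" "z \<in> univ A" for i a z
      using XS that unfolding X_def X2_def by force
    have US: "tuples U n \<subseteq> S" if "U \<in> \<U>" for U
      using unital_poly_span[OF S S3 S4] assms(3)[OF that] by blast
    have "tuples (univ A) n \<subseteq> S"
    proof
      fix u assume u: "u \<in> tuples (univ A) n"
      have "\<exists>xs. u ! j = pol_app A p xs \<and> length xs = k \<and> (\<forall>i<k. xs ! i \<in> Us ! i)"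
        if "j < n" for j
      proof -
        have "u ! j \<in> univ A" using u that by (simp add: tuples_iff)
        then show ?thesis by (subst (asm) sp) blast
      qed
      then obtain x where x: "\<And>j. j < n \<Longrightarrow>
         u ! j = pol_app A p (x j) \<and> length (x j) = k \<and> (\<forall>i<k. x j ! i \<in> Us ! i)"
        by metis
      \<comment> \<open>Transposition: \<open>w i\<close> collects the \<open>i\<close>-th argument
        of \<open>p\<close> over all coordinates.\<close>
      define w where "w i = map (\<lambda>j. x j ! i) [0..<n]" for i
      have "w i \<in> S" if "i < k" for i
      proof -
        have "w i \<in> tuples (Us ! i) n"
          using x that by (auto simp: w_def tuples_iff)
        moreover have "Us ! i \<in> \<U>" using p(2,3) that by auto
        ultimately show ?thesis using US by blast
      qed
      then have "map (\<lambda>j. peval A (\<lambda>i. w i ! j) p) [0..<n] \<in> S"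
        using closed_in_polynomial[OF S S3 p(1)] by blast
      moreover have "map (\<lambda>j. peval A (\<lambda>i. w i ! j) p) [0..<n] = u"
      proof (rule nth_equalityI)
        fix j assume "j < length (map (\<lambda>j. peval A (\<lambda>i. w i ! j) p) [0..<n])"
        then have j: "j < n" by simp
        then have "peval A (\<lambda>i. w i ! j) p = u ! j"
          unfolding x[OF j, THEN conjunct1] pol_app_def
          by (intro peval_cong[OF p(1)]) (simp add: w_def)
        then show "map (\<lambda>j. peval A (\<lambda>i. w i ! j) p) [0..<n] ! j = u ! j"
          using j by simp
      qed (use u in \<open>simp add: tuples_iff\<close>)
      ultimately show "u \<in> S" by simp
    qed
    then have "d_gen A n \<le> card X"
      unfolding S_def by (intro d_gen_le_span[OF assms(1) X])
    with card show ?thesis by simp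
  qed
  then have bound: "d_gen A n \<le> (a + a * a) * n" if "n \<ge> 1" for n
  proof -
    have "a * 1 \<le> a * n" using that by (intro mult_left_mono) auto
    with \<open>d_gen A n \<le> a + n * a * a\<close> have "d_gen A n \<le> a * n + n * a * a" by linarith
    then show ?thesis by (simp add: algebra_simps)
  qed
  show ?thesis
    unfolding d_linear_def
  proof (rule landau_o.bigI[of "real (a + a * a) + 1"])
    show "\<forall>\<^sub>F n in at_top. norm (real (d_gen A n)) \<le> (real (a + a * a) + 1) * norm (real n)"
      using eventually_ge_at_top[of 1]
    proof eventually_elim
      case (elim n)
      have "real (d_gen A n) \<le> real ((a + a * a) * n)" using bound[OF elim] by (rule of_nat_mono)
      then show ?case by (simp add: algebra_simps)
    qed
  qed (simp add: add_nonneg_pos)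
qed

text \<open>The whole algebra is a spread of itself through the identity polynomial, so the general
  spread argument applies to the single set \<open>univ A\<close>.\<close>

lemma maltsev_imp_d_linear:
  assumes "fin_alg A" "has_maltsev_poly A"
  shows "d_linear A"
proof (rule spread_unital_imp_d_linear[OF assms(1)])
  show "spread_of A {univ A} (univ A)"
    unfolding spread_of_def
  proof (intro exI conjI)
    show "pwf A 1 (PV 0)" by simp
    show "univ A = {pol_app A (PV 0) xs |xs. length xs = 1 \<and> (\<forall>i<1. xs ! i \<in> [univ A] ! i)}"
      by (auto simp: pol_app_def intro!: exI[of _ "[x]" for x])
  qed auto
  obtain p where p: "pwf A 3 p"
    "\<forall>x\<in>univ A. \<forall>y\<in>univ A. pol_app A p [x, y, y] = x \<and> pol_app A p [y, y, x] = x"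
    using assms(2) by (auto simp: has_maltsev_poly_def)
  obtain z where z: "z \<in> univ A" using assms(1) by (auto simp: fin_alg_def is_alg_def)
  define q where "q = psubst (\<lambda>i. if i = 0 then PV 0 else if i = 1 then PC z else PV 1) p"
  have "pwf A 2 q" unfolding q_def
    by (rule pwf_psubst[OF p(1)]) (use z in auto)
  moreover have "pol_app A q [x, y] = pol_app A p [x, z, y]" for x y
    unfolding pol_app_def q_def peval_psubst
    by (rule peval_cong[OF p(1)]) (auto simp: less_Suc_eq numeral_3_eq_3)
  ultimately have "unital_poly A (univ A)"
    unfolding unital_poly_def using p(2) z by (intro exI[of _ q] bexI[of _ z]) auto
  then show "U \<subseteq> univ A \<and> unital_poly A U" if "U \<in> {univ A}" for U
    using that by simp
qed

subsection \<open>Pointed cube polynomials\<close>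

text \<open>Reading a tuple along \<open>\<phi>\<close> is a homomorphism from the
  \<open>M\<close>-th to the \<open>N\<close>-th power, so it suffices to look at generators. As
  \<open>\<phi>\<close> may repeat coordinates, it can spread one entry over a whole block.\<close>

lemma reindex_sg:
  assumes "z \<in> sg (pow A M) X" "is_alg A" "X \<subseteq> tuples (univ A) M"
    and "\<And>i. i < N \<Longrightarrow> \<phi> i < M" "closed_in (pow A N) S"
    and "\<And>x. x \<in> X \<Longrightarrow> map (\<lambda>i. x ! \<phi> i) [0..<N] \<in> S"
  shows "map (\<lambda>i. z ! \<phi> i) [0..<N] \<in> S"
proof (rule sg_induct[OF assms(1) is_alg_pow[OF assms(2)]])
  fix f xs assume 4: "f \<in> sig (pow A M)" "length xs = ar (pow A M) f"
    "\<And>x. x \<in> set xs \<Longrightarrow> map (\<lambda>i. x ! \<phi> i) [0..<N] \<in> S"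
  define ys where "ys = map (\<lambda>x. map (\<lambda>i. x ! \<phi> i) [0..<N]) xs"
  have "set ys \<subseteq> S" "length ys = ar A f" using 4 by (auto simp: ys_def)
  then have "opr (pow A N) f ys \<in> S"
    using 4(1) assms(5) by (simp add: closed_in_def del: pow_sel(4))
  moreover have "opr (pow A N) f ys = map (\<lambda>i. opr (pow A M) f xs ! \<phi> i) [0..<N]"
    using assms(4) by (auto simp: ys_def comp_def)
  ultimately show "map (\<lambda>i. opr (pow A M) f xs ! \<phi> i) [0..<N] \<in> S" by (simp only:)
qed (use assms in auto)

text \<open>A tuple that is constant on a block of length \<open>b\<close> is the reindexing of a
  tuple of length \<open>N - b + 1\<close>, whose entry 0 stands for the entire block. Generators of
  that smaller power therefore reach it.\<close>

lemma block_constant_span: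
  assumes A: "is_alg A" and X: "X \<subseteq> tuples (univ A) (N - b + 1)"
      "sg (pow A (N - b + 1)) X = tuples (univ A) (N - b + 1)"
    and S: "closed_in (pow A N) S"
    and l: "l + b \<le> N" "1 \<le> b"
    and XS: "\<And>x. x \<in> X \<Longrightarrow>
      map (\<lambda>j. x ! (if j < l then j + 1 else if j < l + b then 0 else j - b + 1)) [0..<N] \<in> S"
    and u: "u \<in> tuples (univ A) N" "c \<in> univ A" "\<And>j. l \<le> j \<Longrightarrow> j < l + b \<Longrightarrow> u ! j = c"
  shows "u \<in> S"
proof -
  \<comment> \<open>The compressed form of \<open>u\<close>: the block value in front, then the
    entries outside the block in their order.\<close>
  define v where "v = map (\<lambda>j. if j = 0 then c else if j - 1 < l then u ! (j - 1)
    else u ! (j - 1 + b)) [0..<N - b + 1]"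
  have "v \<in> tuples (univ A) (N - b + 1)"
    using u(1,2) l unfolding v_def by (intro map_upt_tuples) (auto simp: tuples_iff)
  then have "v \<in> sg (pow A (N - b + 1)) X" using X(2) by simp
  then have "map (\<lambda>j. v ! (if j < l then j + 1 else if j < l + b then 0 else j - b + 1)) [0..<N] \<in> S"
    by (rule reindex_sg[OF _ A X(1) _ S XS]) (use l in auto)
  also have "map (\<lambda>j. v ! (if j < l then j + 1 else if j < l + b then 0 else j - b + 1)) [0..<N] = u"
  proof (rule nth_equalityI)
    fix j assume "j < length (map (\<lambda>j. v ! (if j < l then j + 1 else if j < l + b then 0
      else j - b + 1)) [0..<N])"
    then have j: "j < N" by simp
    define j' where "j' = (if j < l then j + 1 else if j < l + b then 0 else j - b + 1)"
    have "j' < N - b + 1" using j l by (auto simp: j'_def)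
    then have "v ! j' = (if j' = 0 then c else if j' - 1 < l then u ! (j' - 1)
        else u ! (j' - 1 + b))"
      unfolding v_def by (subst nth_map) (simp_all del: upt_Suc)
    also have "\<dots> = u ! j"
      using l j u(3)[of j] by (auto simp: j'_def)
    finally show "map (\<lambda>j. v ! (if j < l then j + 1 else if j < l + b then 0
      else j - b + 1)) [0..<N] ! j = u ! j"
      using j unfolding j'_def by (simp split del: if_split cong: if_cong)
  qed (use u in \<open>simp add: tuples_iff\<close>)
  finally show ?thesis .
qed

text \<open>Split the coordinates into \<open>k\<close> blocks and use row \<open>i\<close> of the cube identity on block
  \<open>i\<close>: every column then contributes a tuple that is constant on one of the blocks, that is,
  an element of a smaller power.\<close>
lemma cube_recursion:
  assumes "fin_alg A" "has_pointed_cube_poly A"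
  obtains k where "k \<ge> 1"
    "\<And>N. N \<ge> k \<Longrightarrow> d_gen A N \<le> k * d_gen A (N - N div k + 1) + card (univ A)"
proof -
  obtain m k :: nat and p and M :: "nat \<Rightarrow> nat \<Rightarrow> 'a cell"
    where cube: "1 \<le> m \<and> 1 \<le> k \<and> pwf A m p \<and>
     (\<forall>i<k. \<forall>j<m. \<forall>c. M i j = CC c \<longrightarrow> c \<in> univ A) \<and>
     (\<forall>j<m. \<exists>i<k. M i j \<noteq> CV 0) \<and>
     (\<forall>s. (\<forall>v. s v \<in> univ A) \<longrightarrow>
        (\<forall>i<k. pol_app A p (map (\<lambda>j. cell_val s (M i j)) [0..<m]) = s 0))"
    using assms(2) unfolding has_pointed_cube_poly_def by (elim exE) (rule that)
  then have mk: "1 \<le> m" "1 \<le> k" and p: "pwf A m p" and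
    M: "\<And>i j c. i < k \<Longrightarrow> j < m \<Longrightarrow> M i j = CC c \<Longrightarrow> c \<in> univ A"
       "\<And>j. j < m \<Longrightarrow> \<exists>i<k. M i j \<noteq> CV 0" and
    id: "\<And>s i. (\<And>v. s v \<in> univ A) \<Longrightarrow> i < k \<Longrightarrow>
           pol_app A p (map (\<lambda>j. cell_val s (M i j)) [0..<m]) = s 0"
    by blast+
  have A: "is_alg A" "finite (univ A)" using assms(1) by (auto simp: fin_alg_def)
  obtain z where z: "z \<in> univ A" using A by (auto simp: is_alg_def)
  \<comment> \<open>For each column \<open>j\<close>, \<open>r j\<close> is a row, and hence a
    block, in which the column does not show the variable x.\<close>
  obtain r where r: "\<And>j. j < m \<Longrightarrow> r j < k \<and> M (r j) j \<noteq> CV 0" using M(2) by metis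
  have "d_gen A N \<le> k * d_gen A (N - N div k + 1) + card (univ A)" if N: "N \<ge> k" for N
  proof -
    define b where "b = N div k"
    have b: "b \<ge> 1" using N mk(2) by (simp add: b_def div_greater_zero_iff Suc_leI)
    have blk: "i * b + b \<le> N" if "i < k" for i
    proof -
      have "(i + 1) * b \<le> k * b" using that by (intro mult_right_mono) auto
      also have "\<dots> \<le> N" by (simp add: b_def)
      finally show ?thesis by simp
    qed
    obtain Y where Y: "Y \<subseteq> univ (pow A (N - b + 1))" "finite Y" "card Y = d_gen A (N - b + 1)"
      "sg (pow A (N - b + 1)) Y = univ (pow A (N - b + 1))"
      using generators_exist[OF assms(1)] by metis
    define \<phi> where "\<phi> i j = (if j < i * b then j + 1 else if j < i * b + b then 0 else j - b + 1)"
      for i j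
    define R where "R i x = map (\<lambda>j. x ! \<phi> i j) [0..<N]" for i and x :: "'a list"
    define X where "X = replicate N ` univ A \<union> (\<Union>i<k. R i ` Y)"
    have R: "R i x \<in> tuples (univ A) N" if "x \<in> Y" "i < k" for i x
    proof -
      have "\<phi> i j < N - b + 1" if "j < N" for j
        using blk[OF \<open>i < k\<close>] b that by (auto simp: \<phi>_def)
      then show ?thesis
        using Y(1) \<open>x \<in> Y\<close> unfolding R_def by (intro map_upt_tuples) (auto simp: tuples_iff)
    qed
    moreover have "replicate N ` univ A \<subseteq> tuples (univ A) N" by (auto simp: tuples_def)
    ultimately have X: "X \<subseteq> tuples (univ A) N" "finite X"
      using A(2) Y(2) unfolding X_def by blast+
    have "card X \<le> card (replicate N ` univ A) + card (\<Union>i<k. R i ` Y)"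
      unfolding X_def by (rule card_Un_le)
    also have "card (replicate N ` univ A) \<le> card (univ A)" by (rule card_image_le[OF A(2)])
    also have "card (\<Union>i<k. R i ` Y) \<le> (\<Sum>i<k. card (R i ` Y))"
      by (rule card_UN_le) simp
    also have "\<dots> \<le> (\<Sum>i<k. d_gen A (N - b + 1))"
      using card_image_le[OF Y(2)] unfolding Y(3) by (intro sum_mono)
    finally have card: "card X \<le> card (univ A) + k * d_gen A (N - b + 1)" by simp
    define S where "S = sg (pow A N) X"
    have XS: "X \<subseteq> S" unfolding S_def by (rule sg_superset)
    have S: "closed_in (pow A N) S" "S \<subseteq> tuples (univ A) N"
      using sg_subset_univ[OF is_alg_pow[OF A(1)]] X(1) closed_in_sg by (auto simp: S_def)
    have S3: "replicate N c \<in> S" if "c \<in> univ A" for c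
      using XS that by (auto simp: X_def)
    have const: "u \<in> S" if "i < k" "u \<in> tuples (univ A) N" "c \<in> univ A"
      "\<And>j. i * b \<le> j \<Longrightarrow> j < i * b + b \<Longrightarrow> u ! j = c" for u i c
    proof (rule block_constant_span[OF A(1) _ _ S(1) blk[OF \<open>i < k\<close>] b _ that(2-4)])
      fix x assume "x \<in> Y"
      then have "R i x \<in> S" using XS \<open>i < k\<close> unfolding X_def by blast
      then show "map (\<lambda>j. x ! (if j < i * b then j + 1 else if j < i * b + b then 0
          else j - b + 1)) [0..<N] \<in> S"
        by (simp add: R_def \<phi>_def)
    qed (use Y in auto)
    \<comment> \<open>The row used at coordinate \<open>j\<close>. The minimum sends the coordinates
      left over by the division to the last row; they belong to no block, and constancy is only
      claimed on blocks.\<close>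
    define \<rho> where "\<rho> j = min (j div b) (k - 1)" for j
    have \<rho>: "\<rho> j < k" for j using mk(2) by (auto simp: \<rho>_def)
    have "u \<in> S" if u: "u \<in> tuples (univ A) N" for u
    proof -
      \<comment> \<open>At coordinate \<open>j\<close> the variable x gets the wanted value
        \<open>u ! j\<close> and all other variables the fixed value \<open>z\<close>. A cell
        different from x thus has a value independent of \<open>j\<close>, which makes
        \<open>w c\<close> constant on block \<open>r c\<close>.\<close>
      define s where "s j v = (if v = (0::nat) then u ! j else z)" for j v
      define w where "w c = map (\<lambda>j. cell_val (s j) (M (\<rho> j) c)) [0..<N]" for c
      have cell: "cell_val (s j) (M i c) \<in> univ A" if "j < N" "i < k" "c < m" for j i c
        using u z M(1)[OF that(2,3)] that by (cases "M i c") (auto simp: s_def tuples_iff)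
      have "w c \<in> S" if "c < m" for c
      proof (rule const)
        show "r c < k" using r that by blast
        have "0 < N" using N mk by simp
        then show "cell_val (\<lambda>_. z) (M (r c) c) \<in> univ A"
          using r[OF that] z M(1)[OF _ that, of "r c"] by (cases "M (r c) c") auto
        show "w c \<in> tuples (univ A) N"
          unfolding w_def using \<rho> cell that by (intro map_upt_tuples) auto
        fix j assume j: "r c * b \<le> j" "j < r c * b + b"
        then have "j div b = r c"
          using b by (intro div_nat_eqI) (simp_all add: mult.commute)
        then have "\<rho> j = r c" using r[OF that] by (auto simp: \<rho>_def)
        moreover have "j < N" using j(2) blk r[OF that] by (meson less_le_trans)
        ultimately show "w c ! j = cell_val (\<lambda>_. z) (M (r c) c)"
          using r[OF that] by (cases "M (r c) c") (auto simp: w_def s_def)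
      qed
      then have "map (\<lambda>j. peval A (\<lambda>i. w i ! j) p) [0..<N] \<in> S"
        using closed_in_polynomial[OF S S3 p] by blast
      moreover have "map (\<lambda>j. peval A (\<lambda>i. w i ! j) p) [0..<N] = u"
      proof (rule nth_equalityI)
        fix j assume "j < length (map (\<lambda>j. peval A (\<lambda>i. w i ! j) p) [0..<N])"
        then have j: "j < N" by simp
        have "peval A (\<lambda>i. w i ! j) p =
            pol_app A p (map (\<lambda>c. cell_val (s j) (M (\<rho> j) c)) [0..<m])"
          unfolding pol_app_def by (rule peval_cong[OF p]) (use j in \<open>simp add: w_def\<close>)
        also have "\<dots> = s j 0"
          by (rule id[OF _ \<rho>]) (use u z j in \<open>auto simp: s_def tuples_iff\<close>)
        finally show "map (\<lambda>j. peval A (\<lambda>i. w i ! j) p) [0..<N] ! j = u ! j"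
          using j by (simp add: s_def)
      qed (use u in \<open>simp add: tuples_iff\<close>)
      ultimately show ?thesis by simp
    qed
    then have "d_gen A N \<le> card X"
      unfolding S_def by (intro d_gen_le_span[OF assms(1) X]) auto
    with card show ?thesis by (simp add: b_def)
  qed
  with that mk(2) show ?thesis by blast
qed

text \<open>Strong induction for the bound \<open>C * 2 powr (\<epsilon> * real N)\<close>. Passing
  from \<open>N\<close> to \<open>N - b + 1\<close> saves the factor
  \<open>2 powr (\<epsilon> * (real b - 1))\<close>, which for \<open>b\<close> at least
  \<open>L\<close> pays for the \<open>k\<close> recursive terms and for the constant tuples, hence
  \<open>k + 1\<close>.\<close>

lemma cube_imp_d_not_exp:
  assumes "fin_alg A" "has_pointed_cube_poly A"
  shows "d_not_exp A"
proof (rule d_not_expI)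
  obtain k where k: "k \<ge> 1"
    "\<And>N. N \<ge> k \<Longrightarrow> d_gen A N \<le> k * d_gen A (N - N div k + 1) + card (univ A)"
    using cube_recursion[OF assms] by metis
  fix \<epsilon> :: real assume \<epsilon>: "\<epsilon> > 0"
  have "filterlim (\<lambda>L. 2 powr (\<epsilon> * (real L - 1))) at_top at_top"
    using \<epsilon> by real_asymp
  then have "\<forall>\<^sub>F L :: nat in at_top. real k + 1 \<le> 2 powr (\<epsilon> * (real L - 1)) \<and> L \<ge> 2"
    by (intro eventually_conj eventually_ge_at_top) (simp only: filterlim_at_top)
  then obtain L :: nat where L: "real k + 1 \<le> 2 powr (\<epsilon> * (real L - 1))" "L \<ge> 2"
    by (auto dest: eventually_happens)
  \<comment> \<open>Large enough for all \<open>N\<close> below \<open>k * L\<close>, where the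
    blocks are too short, and for the additive term of the recursion.\<close>
  define C where "C = real (card (univ A)) + (\<Sum>N<k * L. real (d_gen A N))"
  have C: "C \<ge> card (univ A)" by (simp add: C_def sum_nonneg)
  then have "C \<ge> 0" by simp
  have "real (d_gen A N) \<le> C * 2 powr (\<epsilon> * real N)" for N
  proof (induction N rule: less_induct)
    case (less N)
    show ?case
    proof (cases "N < k * L")
      case True
      then have "real (d_gen A N) \<le> (\<Sum>N<k * L. real (d_gen A N))"
        by (intro member_le_sum) auto
      also have "\<dots> \<le> C" by (simp add: C_def)
      also have "C * 1 \<le> C * 2 powr (\<epsilon> * real N)"
        using \<open>C \<ge> 0\<close> \<epsilon> by (intro mult_left_mono ge_one_powr_ge_zero) auto
      finally show ?thesis by simp
    next
      case False
      define b where "b = N div k"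
      have b: "L \<le> b" using False k(1)
        by (simp add: b_def less_eq_div_iff_mult_less_eq mult.commute)
      have "b \<le> N" by (simp add: b_def)
      define N' where "N' = N - b + 1"
      have N': "N' < N" "real N' = real N - (real b - 1)"
        using b L(2) \<open>b \<le> N\<close> by (auto simp: N'_def)
      have one: "1 \<le> 2 powr (\<epsilon> * real N')" using \<epsilon> by (intro ge_one_powr_ge_zero) auto
      have "k * 1 \<le> k * L" using L(2) by (intro mult_left_mono) auto
      then have "k \<le> N" using False by linarith
      then have "d_gen A N \<le> k * d_gen A N' + card (univ A)"
        unfolding N'_def b_def by (rule k(2))
      then have "real (d_gen A N) \<le> real k * real (d_gen A N') + real (card (univ A))"
        by (metis of_nat_add of_nat_le_iff of_nat_mult)
      also have "\<dots> \<le> real k * (C * 2 powr (\<epsilon> * real N')) + C * 2 powr (\<epsilon> * real N')"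
      proof (intro add_mono mult_left_mono less.IH N')
        have "C * 1 \<le> C * 2 powr (\<epsilon> * real N')" by (intro mult_left_mono one \<open>C \<ge> 0\<close>)
        then show "real (card (univ A)) \<le> C * 2 powr (\<epsilon> * real N')" using C by simp
      qed simp
      also have "\<dots> = (real k + 1) * (C * 2 powr (\<epsilon> * real N'))" by (simp add: algebra_simps)
      also have "\<dots> \<le> 2 powr (\<epsilon> * (real b - 1)) * (C * 2 powr (\<epsilon> * real N'))"
      proof (rule mult_right_mono)
        have "2 powr (\<epsilon> * (real L - 1)) \<le> 2 powr (\<epsilon> * (real b - 1))"
          using b \<epsilon> by (intro powr_mono mult_left_mono) auto
        then show "real k + 1 \<le> 2 powr (\<epsilon> * (real b - 1))" using L(1) by linarith
      qed (use \<open>C \<ge> 0\<close> in simp)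
      also have "\<dots> = C * 2 powr (\<epsilon> * (real b - 1) + \<epsilon> * real N')"
        by (simp add: powr_add)
      also have "\<epsilon> * (real b - 1) + \<epsilon> * real N' = \<epsilon> * real N"
        unfolding N'(2) by (simp add: algebra_simps)
      finally show ?thesis .
    qed
  qed
  then show "\<exists>C. \<forall>\<^sub>F n in at_top. real (d_gen A n) \<le> C * 2 powr (\<epsilon> * real n)"
    by (intro exI[of _ C]) simp
qed

subsection \<open>Strongly abelian quotients\<close>

lemma quot_sel [simp]:
  "univ (quot A \<theta>) = univ A // \<theta>" "sig (quot A \<theta>) = sig A" "ar (quot A \<theta>) = ar A"
  by (simp_all add: quot_def)

text \<open>The representatives chosen by \<open>SOME\<close> inside \<open>quot\<close> are
  congruent to \<open>xs\<close> entry by entry, so compatibility of \<open>\<theta>\<close> makes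
  the choice irrelevant.\<close>

lemma quot_opr:
  assumes "con B \<theta>" "f \<in> sig B" "length xs = ar B f" "set xs \<subseteq> univ B"
  shows "opr (quot B \<theta>) f (map (\<lambda>x. \<theta> `` {x}) xs) = \<theta> `` {opr B f xs}"
proof -
  have eq: "equiv (univ B) \<theta>" using assms(1) by (simp add: con_def)
  define ys where "ys = map (\<lambda>x. SOME y. y \<in> \<theta> `` {x}) xs"
  have "(x, SOME y. y \<in> \<theta> `` {x}) \<in> \<theta>" if "x \<in> set xs" for x
    using someI[of "\<lambda>y. y \<in> \<theta> `` {x}" x] assms(4) that eq
    by (auto simp: equiv_def refl_on_def)
  then have "list_all2 (\<lambda>x y. (x, y) \<in> \<theta>) xs ys"
    by (auto simp: ys_def list_all2_conv_all_nth)
  then have "(opr B f xs, opr B f ys) \<in> \<theta>"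
    using assms(1-3) by (simp add: con_def ys_def)
  then have "\<theta> `` {opr B f xs} = \<theta> `` {opr B f ys}"
    using equiv_class_eq[OF eq] by blast
  then show ?thesis by (simp add: quot_def ys_def comp_def)
qed

lemma is_alg_quot:
  assumes "is_alg B" "con B \<theta>" shows "is_alg (quot B \<theta>)"
proof -
  have "opr (quot B \<theta>) f Cs \<in> univ B // \<theta>"
    if f: "f \<in> sig B" "length Cs = ar B f" "set Cs \<subseteq> univ B // \<theta>" for f Cs
  proof -
    have "\<forall>C\<in>set Cs. \<exists>x. x \<in> univ B \<and> C = \<theta> `` {x}"
      using f(3) by (auto simp: quotient_def)
    then obtain r where r: "\<And>C. C \<in> set Cs \<Longrightarrow> r C \<in> univ B \<and> C = \<theta> `` {r C}" by metis
    have "map (\<lambda>x. \<theta> `` {x}) (map r Cs) = map (\<lambda>C. C) Cs"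
      unfolding map_map by (rule map_cong) (use r in auto)
    then have "opr (quot B \<theta>) f Cs = \<theta> `` {opr B f (map r Cs)}"
      using quot_opr[OF assms(2) f(1), of "map r Cs"] f(2) r by (auto simp: image_subset_iff)
    moreover have "set (map r Cs) \<subseteq> univ B" using r by auto
    then have "opr B f (map r Cs) \<in> univ B"
      using assms(1) f by (simp add: is_alg_def)
    ultimately show ?thesis by (simp add: quotientI)
  qed
  then show ?thesis using assms(1) by (auto simp: is_alg_def quotient_def)
qed

text \<open>The strong term condition with the single variable \<open>i\<close> as second block: if
  \<open>a\<close> and \<open>b\<close> can give the same value of \<open>t\<close> in two contexts,
  no context tells them apart.\<close>

lemma strongly_abelian_var:
  assumes "strongly_abelian Q" "is_term Q g t" "a \<in> univ Q" "b \<in> univ Q"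
    and "\<And>j. r j \<in> univ Q" "\<And>j. r' j \<in> univ Q" "\<And>j. s j \<in> univ Q"
    and "peval Q (r(i := a)) t = peval Q (r'(i := b)) t"
  shows "peval Q (s(i := a)) t = peval Q (s(i := b)) t"
proof -
  \<comment> \<open>The definition wants the second block at the end, so variable \<open>i\<close>
    is renamed to the fresh index \<open>g\<close>; position \<open>i\<close> of the first block
    becomes a dummy.\<close>
  define t' where "t' = psubst (\<lambda>j. if j = i then PV g else PV j) t"
  have t: "pwf Q g t" "noconst t" using assms(2) by (auto simp: is_term_def)
  have "pwf Q (g + 1) t'" unfolding t'_def by (rule pwf_psubst[OF t(1)]) auto
  moreover have "noconst t'" unfolding t'_def by (rule noconst_psubst[OF t(2)]) auto
  ultimately have t': "is_term Q (g + 1) t'" by (simp add: is_term_def)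
  have ev: "pol_app Q t' (map r [0..<g] @ [c]) = peval Q (r(i := c)) t" for r c
    unfolding pol_app_def t'_def peval_psubst
    by (rule peval_cong[OF t(1)]) (auto simp: nth_append)
  have "pol_app Q t' (map s [0..<g] @ [a]) = pol_app Q t' (map s [0..<g] @ [b])"
  proof (rule assms(1)[unfolded strongly_abelian_def, rule_format, OF t'])
    show "pol_app Q t' (map r [0..<g] @ [a]) = pol_app Q t' (map r' [0..<g] @ [b])"
      using assms(8) by (simp add: ev)
  qed (use assms(3-7) in \<open>auto intro!: map_upt_tuples simp: tuples_def\<close>)
  then show ?thesis by (simp add: ev)
qed

text \<open>By strong abelianness, two values \<open>e i\<close>, \<open>f i\<close> of an essential variable are told apart by
  the term whatever the other arguments are.  Hence \<open>card S\<close> essential variables produce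
  \<open>2 ^ card S\<close> distinct values.\<close>
lemma strongly_abelian_essential_variables:
  assumes "strongly_abelian Q" "is_term Q g t" "is_alg Q" "finite (univ Q)"
  obtains S where "S \<subseteq> {..<g}" "card S \<le> card (univ Q)"
    "\<And>s s'. (\<And>j. s j \<in> univ Q) \<Longrightarrow> (\<And>j. s' j \<in> univ Q) \<Longrightarrow> (\<And>j. j \<in> S \<Longrightarrow> s j = s' j) \<Longrightarrow>
       peval Q s t = peval Q s' t"
proof -
  let ?U = "univ Q"
  define S where "S = {i. i < g \<and> (\<exists>s a b. (\<forall>j. s j \<in> ?U) \<and> a \<in> ?U \<and> b \<in> ?U \<and>
    peval Q (s(i := a)) t \<noteq> peval Q (s(i := b)) t)}"
  have t: "pwf Q g t" using assms(2) by (simp add: is_term_def)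
  have indep: "peval Q s t = peval Q s' t"
    if s: "\<And>j. s j \<in> ?U" "\<And>j. s' j \<in> ?U" "\<And>j. j \<in> S \<Longrightarrow> s j = s' j" for s s'
  proof -
    \<comment> \<open>Variables are switched from \<open>s\<close> to \<open>s'\<close> one at a
      time; an inessential one changes nothing, and on an essential one both assignments
      agree.\<close>
    have "peval Q (\<lambda>i. if i < k then s' i else s i) t = peval Q s t" if "k \<le> g" for k
      using that
    proof (induction k)
      case (Suc k)
      define h where "h = (\<lambda>i. if i < k then s' i else s i)"
      have h: "h j \<in> ?U" for j using s by (auto simp: h_def)
      have "h = h(k := s k)" "(\<lambda>i. if i < Suc k then s' i else s i) = h(k := s' k)"
        by (auto simp: h_def fun_eq_iff less_Suc_eq)
      moreover have "peval Q (h(k := s k)) t = peval Q (h(k := s' k)) t"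
      proof (cases "k \<in> S")
        case False
        then have "\<And>r a b. (\<forall>j. r j \<in> ?U) \<Longrightarrow> a \<in> ?U \<Longrightarrow> b \<in> ?U \<Longrightarrow>
            peval Q (r(k := a)) t = peval Q (r(k := b)) t"
          using False Suc.prems unfolding S_def mem_Collect_eq by (meson Suc_le_lessD)
        then show ?thesis using h s(1,2) by blast
      qed (use s(3) in simp)
      ultimately show ?case using Suc by (simp add: h_def)
    qed simp
    from this[of g] have "peval Q (\<lambda>i. if i < g then s' i else s i) t = peval Q s t" by simp
    moreover have "peval Q (\<lambda>i. if i < g then s' i else s i) t = peval Q s' t"
      by (rule peval_cong[OF t]) simp
    ultimately show ?thesis by simp
  qed
  define W where "W i e f \<longleftrightarrow> e \<in> ?U \<and> f \<in> ?U \<and> (\<forall>r r'. (\<forall>j. r j \<in> ?U) \<longrightarrow>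
      (\<forall>j. r' j \<in> ?U) \<longrightarrow> peval Q (r(i := e)) t \<noteq> peval Q (r'(i := f)) t)" for i e f
  have "\<exists>e f. W i e f" if "i \<in> S" for i
  proof -
    obtain s a b where "\<And>j. s j \<in> ?U" "a \<in> ?U" "b \<in> ?U"
      "peval Q (s(i := a)) t \<noteq> peval Q (s(i := b)) t" using \<open>i \<in> S\<close> by (auto simp: S_def)
    then have "W i a b"
      using strongly_abelian_var[OF assms(1,2), of a b _ _ s i] unfolding W_def by blast
    then show ?thesis by blast
  qed
  then obtain e f where "\<And>i. i \<in> S \<Longrightarrow> W i (e i) (f i)" by metis
  then have ef: "\<And>i. i \<in> S \<Longrightarrow> e i \<in> ?U" "\<And>i. i \<in> S \<Longrightarrow> f i \<in> ?U"
    "\<And>i r r'. i \<in> S \<Longrightarrow> (\<And>j. r j \<in> ?U) \<Longrightarrow> (\<And>j. r' j \<in> ?U) \<Longrightarrow>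
       peval Q (r(i := e i)) t \<noteq> peval Q (r'(i := f i)) t"
    by (simp_all add: W_def)
  obtain d where d: "d \<in> ?U" using assms(3) by (auto simp: is_alg_def)
  \<comment> \<open>A subset \<open>T\<close> of \<open>S\<close> is coded by giving variable
    \<open>i\<close> the value \<open>f i\<close> inside \<open>T\<close> and \<open>e i\<close>
    outside; a variable in which two subsets differ separates the values.\<close>
  define v where "v T i = (if i \<in> T then f i else if i \<in> S then e i else d)" for T i
  have v: "v T j \<in> ?U" if "T \<subseteq> S" for T j using that ef d by (auto simp: v_def)
  have dist: "peval Q (v T) t \<noteq> peval Q (v T') t"
    if "T \<subseteq> S" "T' \<subseteq> S" "i \<in> T" "i \<notin> T'" for T T' i
  proof -
    have "v T = (v T)(i := f i)" "v T' = (v T')(i := e i)"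
      using that by (auto simp: v_def fun_eq_iff)
    then show ?thesis using ef(3)[of i "v T'" "v T"] v that by (metis in_mono)
  qed
  have "inj_on (\<lambda>T. peval Q (v T) t) (Pow S)"
  proof (rule inj_onI, rule ccontr)
    fix T T' assume T: "T \<in> Pow S" "T' \<in> Pow S" "peval Q (v T) t = peval Q (v T') t" "T \<noteq> T'"
    then obtain i where "i \<in> T \<and> i \<notin> T' \<or> i \<in> T' \<and> i \<notin> T" by auto
    then show False using dist[of T T' i] dist[of T' T i] T by auto
  qed
  moreover have "(\<lambda>T. peval Q (v T) t) ` Pow S \<subseteq> ?U"
    using v peval_closed[OF assms(3) t] by auto
  ultimately have "card (Pow S) \<le> card ?U"
    using card_inj_on_le assms(4) by blast
  moreover have "finite S" by (rule finite_subset[of _ "{..<g}"]) (auto simp: S_def)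
  ultimately have "2 ^ card S \<le> card ?U" by (simp add: card_Pow)
  \<comment> \<open>The logarithmic bound on \<open>card S\<close> is weakened to a linear one,
    which is enough for counting.\<close>
  moreover have "card S < 2 ^ card S" by (rule less_exp)
  ultimately have "card S \<le> card ?U" by linarith
  moreover have "S \<subseteq> {..<g}" by (auto simp: S_def)
  ultimately show ?thesis using that indep by blast
qed

text \<open>Listing the essential variables turns a term into finite data: a list \<open>js\<close>
  of exactly \<open>q\<close> indices and an operation table \<open>G\<close>. The number of such
  pairs is polynomial in \<open>g\<close> for fixed \<open>q\<close>.\<close>

lemma strongly_abelian_factor_through_tuples:
  fixes g :: nat
  assumes "strongly_abelian Q" "is_term Q g t" "is_alg Q" "finite (univ Q)"
  defines "q \<equiv> card (univ Q)"
  obtains js G where "js \<in> tuples {..g} q" "G \<in> tuples (univ Q) q \<rightarrow>\<^sub>E univ Q"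
    "\<And>s. (\<And>j. s j \<in> univ Q) \<Longrightarrow> peval Q s t = G (map s js)"
proof -
  obtain S where S: "S \<subseteq> {..<g}" "card S \<le> q"
    "\<And>s s'. (\<And>j. s j \<in> univ Q) \<Longrightarrow> (\<And>j. s' j \<in> univ Q) \<Longrightarrow> (\<And>j. j \<in> S \<Longrightarrow> s j = s' j) \<Longrightarrow>
       peval Q s t = peval Q s' t"
    using strongly_abelian_essential_variables[OF assms(1-4)] unfolding q_def by metis
  obtain d where d: "d \<in> univ Q" using assms(3) by (auto simp: is_alg_def)
  have "finite S" using S(1) finite_subset by blast
  then obtain l where l: "set l = S" "length l = card S"
    using finite_distinct_list distinct_card by metis
  \<comment> \<open>Padding with the index \<open>g\<close>, which is no variable of
    \<open>t\<close>, gives all lists the same length; this is why there are \<open>g + 1\<close>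
    possible entries.\<close>
  define js' where "js' = l @ replicate (q - card S) g"
  have js': "js' \<in> tuples {..g} q" "S \<subseteq> set js'"
    using S(1,2) l by (auto simp: js'_def tuples_def)
  then have "\<forall>i\<in>S. \<exists>p<q. js' ! p = i" by (auto simp: in_set_conv_nth tuples_def)
  then obtain pos where pos: "\<And>i. i \<in> S \<Longrightarrow> pos i < q \<and> js' ! pos i = i" by metis
  define h where "h l i = (if i \<in> S then l ! pos i else d)" for l i
  define G where "G = restrict (\<lambda>l. peval Q (h l) t) (tuples (univ Q) q)"
  have h: "h l i \<in> univ Q" if "l \<in> tuples (univ Q) q" for l i
    using pos that d by (auto simp: h_def tuples_iff)
  have "G \<in> tuples (univ Q) q \<rightarrow>\<^sub>E univ Q"
    unfolding G_def using assms(2) h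
    by (intro restrict_PiE_iff[THEN iffD2] ballI peval_closed[OF assms(3)]) (auto simp: is_term_def)
  moreover have "peval Q s t = G (map s js')" if s: "\<And>j. s j \<in> univ Q" for s
  proof -
    have ms: "map s js' \<in> tuples (univ Q) q" using js'(1) s by (auto simp: tuples_def)
    have "peval Q s t = peval Q (h (map s js')) t"
      by (rule S(3)[OF s h[OF ms]]) (use pos js'(1) in \<open>auto simp: h_def tuples_def\<close>)
    then show ?thesis using ms by (simp add: G_def)
  qed
  ultimately show ?thesis using that js'(1) by blast
qed

text \<open>Cutting tuples into blocks of length \<open>m\<close> and passing to classes maps the
  \<open>N\<close>-th power of \<open>A\<close> homomorphically onto the power of the quotient with
  exponent \<open>N div m\<close>. The images of the generators generate that power, and the terms
  producing its elements are counted by their pairs \<open>js\<close>, \<open>G\<close>.\<close>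

lemma strongly_abelian_image_count:
  assumes "fin_alg A" "con (pow A m) \<theta>" "strongly_abelian (quot (pow A m) \<theta>)" "m \<ge> 1"
  defines "q \<equiv> card (univ (quot (pow A m) \<theta>))"
  shows "q ^ (N div m) \<le> (d_gen A N + 1) ^ q * q ^ (q ^ q)"
proof -
  define Q where "Q = quot (pow A m) \<theta>"
  define n where "n = N div m"
  define g where "g = d_gen A N"
  have A: "is_alg A" "finite (univ A)" using assms(1) by (auto simp: fin_alg_def)
  obtain a0 where a0: "a0 \<in> univ A" using A by (auto simp: is_alg_def)
  have algs: "is_alg (pow A m)" "is_alg (pow A N)" "is_alg Q"
    using is_alg_pow A is_alg_quot assms(2) by (auto simp: Q_def)
  have univQ: "univ Q = tuples (univ A) m // \<theta>" by (simp add: Q_def)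
  have finQ: "finite (univ Q)"
    using assms(2) finite_tuples[OF A(2), of m] unfolding univQ
    by (intro finite_quotient) (auto simp: con_def equiv_def)
  define blk where "blk j z = map (\<lambda>i. z ! (j * m + i)) [0..<m]" for j and z :: "'a list"
  define \<kappa> where "\<kappa> j z = \<theta> `` {blk j z}" for j z
  have pos: "j * m + i < N" if "j < n" "i < m" for i j
  proof -
    have "j * m + i < (j + 1) * m" using that by simp
    also have "\<dots> \<le> n * m" using that by (intro mult_right_mono) auto
    also have "\<dots> \<le> N" by (simp add: n_def)
    finally show ?thesis .
  qed
  have blk: "blk j z \<in> tuples (univ A) m" if "j < n" "z \<in> tuples (univ A) N" for j z
    unfolding blk_def using that pos by (intro map_upt_tuples) (auto simp: tuples_iff)
  have \<kappa>: "\<kappa> j z \<in> univ Q" if "j < n" "z \<in> tuples (univ A) N" for j z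
    unfolding \<kappa>_def univQ using blk[OF that] by (rule quotientI)
  obtain X where X: "X \<subseteq> univ (pow A N)" "finite X" "card X = g"
    "sg (pow A N) X = univ (pow A N)"
    using generators_exist[OF assms(1)] unfolding g_def by metis
  obtain xs where xs: "set xs = X" "length xs = g"
    using finite_distinct_list[OF X(2)] distinct_card X(3) by metis
  \<comment> \<open>One term \<open>t\<close> serves all blocks \<open>j\<close> simultaneously;
    this is what bounds the number of elements by the number of terms.\<close>
  have rep: "\<exists>t. is_term Q g t \<and> (\<forall>j<n. \<kappa> j z = peval Q (\<lambda>i. \<kappa> j (xs ! i)) t)"
    if "z \<in> tuples (univ A) N" for z
  proof (rule sg_induct[where X = X and B = "pow A N"])
    show "z \<in> sg (pow A N) X" using that X(4) by simp
    fix x assume "x \<in> X"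
    then obtain i where "i < g" "x = xs ! i" using xs by (metis in_set_conv_nth)
    then show "\<exists>t. is_term Q g t \<and> (\<forall>j<n. \<kappa> j x = peval Q (\<lambda>i. \<kappa> j (xs ! i)) t)"
      by (intro exI[of _ "PV i"]) (simp add: is_term_def)
  next
    fix f zs
    assume f: "f \<in> sig (pow A N)" "length zs = ar (pow A N) f" "set zs \<subseteq> univ (pow A N)"
      and "\<And>z. z \<in> set zs \<Longrightarrow>
        \<exists>t. is_term Q g t \<and> (\<forall>j<n. \<kappa> j z = peval Q (\<lambda>i. \<kappa> j (xs ! i)) t)"
    then obtain tt where tt: "\<And>z. z \<in> set zs \<Longrightarrow> is_term Q g (tt z)"
      "\<And>z j. z \<in> set zs \<Longrightarrow> j < n \<Longrightarrow> \<kappa> j z = peval Q (\<lambda>i. \<kappa> j (xs ! i)) (tt z)"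
      by metis
    have "is_term Q g (PA f (map tt zs))"
      using tt(1) f by (auto simp: is_term_def Q_def)
    moreover have "\<kappa> j (opr (pow A N) f zs) = peval Q (\<lambda>i. \<kappa> j (xs ! i)) (PA f (map tt zs))"
      if "j < n" for j
    proof -
      have "blk j (opr (pow A N) f zs) = opr (pow A m) f (map (blk j) zs)"
        using pos[OF that] by (auto simp: blk_def comp_def)
      then have "\<kappa> j (opr (pow A N) f zs) = \<theta> `` {opr (pow A m) f (map (blk j) zs)}"
        by (simp only: \<kappa>_def)
      also have "\<dots> = opr Q f (map (\<lambda>x. \<theta> `` {x}) (map (blk j) zs))"
        unfolding Q_def
        by (rule quot_opr[OF assms(2), symmetric]) (use f blk[OF that] in auto)
      also have "map (\<lambda>x. \<theta> `` {x}) (map (blk j) zs) = map (\<kappa> j) zs" by (simp add: \<kappa>_def)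
      also have "map (\<kappa> j) zs = map (peval Q (\<lambda>i. \<kappa> j (xs ! i))) (map tt zs)"
        using tt(2) that by simp
      finally show ?thesis by (simp only: peval.simps)
    qed
    ultimately show "\<exists>t. is_term Q g t \<and>
        (\<forall>j<n. \<kappa> j (opr (pow A N) f zs) = peval Q (\<lambda>i. \<kappa> j (xs ! i)) t)"
      by blast
  qed (use algs X in auto)
  obtain d where d: "d \<in> univ Q" using algs(3) by (auto simp: is_alg_def)
  \<comment> \<open>Images of the generators in block \<open>j\<close>, with the default
    \<open>d\<close> at the padding index \<open>g\<close>.\<close>
  define \<sigma> where "\<sigma> j i = (if i < g then \<kappa> j (xs ! i) else d)" for j i
  have \<sigma>: "\<sigma> j i \<in> univ Q" if "j < n" for j i
    using \<kappa>[OF that, of "xs ! i"] d X(1) xs nth_mem[of i xs] by (auto simp: \<sigma>_def)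
  define \<Psi> where "\<Psi> = (\<lambda>(js, G :: 'a list set list \<Rightarrow> 'a list set). map (\<lambda>j. G (map (\<sigma> j) js)) [0..<n])"
  define D where "D = tuples {..g} q \<times> (tuples (univ Q) q \<rightarrow>\<^sub>E univ Q)"
  have qQ: "q = card (univ Q)" by (simp add: q_def Q_def)
  have "tuples (univ Q) n \<subseteq> \<Psi> ` D"
  proof
    fix u assume u: "u \<in> tuples (univ Q) n"
    have "\<forall>j. \<exists>y. j < n \<longrightarrow> y \<in> tuples (univ A) m \<and> u ! j = \<theta> `` {y}"
    proof -
      have "u ! j \<in> tuples (univ A) m // \<theta>" if "j < n" for j
        using u that unfolding univQ[symmetric] by (simp add: tuples_iff)
      then show ?thesis by (metis quotientE)
    qed
    then obtain y where y: "\<And>j. j < n \<Longrightarrow> y j \<in> tuples (univ A) m \<and> u ! j = \<theta> `` {y j}"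
      by metis
    \<comment> \<open>Surjectivity: representatives of the prescribed classes are concatenated, and
      the coordinates beyond the last full block get the default \<open>a0\<close>.\<close>
    define z where "z = map (\<lambda>l. if l div m < n then y (l div m) ! (l mod m) else a0) [0..<N]"
    have z: "z \<in> tuples (univ A) N"
      unfolding z_def using y a0 assms(4) by (intro map_upt_tuples) (auto simp: tuples_iff)
    have \<kappa>z: "\<kappa> j z = u ! j" if "j < n" for j
    proof -
      have "blk j z = y j"
        using y[OF that] pos[OF that] that
        by (intro nth_equalityI) (auto simp: blk_def z_def tuples_iff)
      then show ?thesis using y[OF that] by (simp add: \<kappa>_def)
    qed
    obtain t where t: "is_term Q g t" "\<And>j. j < n \<Longrightarrow> \<kappa> j z = peval Q (\<lambda>i. \<kappa> j (xs ! i)) t"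
      using rep[OF z] by blast
    obtain js G where G: "js \<in> tuples {..g} q" "G \<in> tuples (univ Q) q \<rightarrow>\<^sub>E univ Q"
      "\<And>s. (\<And>j. s j \<in> univ Q) \<Longrightarrow> peval Q s t = G (map s js)"
      using strongly_abelian_factor_through_tuples[OF _ t(1) algs(3) finQ] assms(3)
      unfolding Q_def q_def by metis
    have "u ! j = G (map (\<sigma> j) js)" if "j < n" for j
    proof -
      have "u ! j = peval Q (\<lambda>i. \<kappa> j (xs ! i)) t" using t(2) \<kappa>z that by simp
      also have "\<dots> = peval Q (\<sigma> j) t"
        by (rule peval_cong[of _ g]) (use t(1) in \<open>auto simp: is_term_def \<sigma>_def\<close>)
      also have "\<dots> = G (map (\<sigma> j) js)" by (rule G(3)[OF \<sigma>[OF that]])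
      finally show ?thesis .
    qed
    then have "u = \<Psi> (js, G)"
      using u by (auto simp: \<Psi>_def tuples_iff intro!: nth_equalityI)
    then show "u \<in> \<Psi> ` D" using G by (auto simp: D_def)
  qed
  moreover have finT: "finite (tuples (univ Q) q)" "finite (tuples {..g} q)"
    using finite_tuples finQ by auto
  then have finD: "finite D" unfolding D_def by (intro finite_cartesian_product finite_PiE) (auto simp: finQ)
  ultimately have "card (tuples (univ Q) n) \<le> card D"
    using surj_card_le by metis
  moreover have "card D = (g + 1) ^ q * q ^ (q ^ q)"
    unfolding D_def card_cartesian_product
    using finT(1) finQ by (simp add: card_funcsetE card_tuples qQ)
  ultimately show ?thesis
    using finQ by (simp add: card_tuples qQ g_def n_def)
qed

lemma d_not_exp_imp_no_sa_image:
  assumes "fin_alg A" "d_not_exp A"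
  shows "no_sa_image A"
proof (rule ccontr)
  assume "\<not> no_sa_image A"
  then obtain m \<theta> where con: "con (pow A m) \<theta>" and
    nt: "\<exists>x\<in>univ (quot (pow A m) \<theta>). \<exists>y\<in>univ (quot (pow A m) \<theta>). x \<noteq> y" and
    sa: "strongly_abelian (quot (pow A m) \<theta>)"
    unfolding no_sa_image_def by blast
  \<comment> \<open>The power with exponent 0 has one element and hence no nontrivial image.\<close>
  have m: "m \<ge> 1"
  proof (rule ccontr)
    assume "\<not> m \<ge> 1"
    then have "m = 0" by simp
    then have "univ (pow A m) = {[]}" by (auto simp: tuples_def)
    then show False using nt by (auto simp: quotient_def)
  qed
  define q where "q = card (univ (quot (pow A m) \<theta>))"
  have fin: "finite (univ (quot (pow A m) \<theta>))"
    using con assms(1) finite_tuples[of "univ A" m] unfolding quot_sel pow_sel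
    by (intro finite_quotient) (auto simp: con_def equiv_def fin_alg_def)
  have q: "q \<ge> 2"
  proof -
    obtain x y where "{x, y} \<subseteq> univ (quot (pow A m) \<theta>)" "x \<noteq> y" using nt by blast
    then show ?thesis unfolding q_def using card_mono[OF fin, of "{x, y}"] by simp
  qed
  define K where "K = real q ^ (q ^ q)"
  \<comment> \<open>Chosen so that the \<open>q\<close>-th power of
    \<open>2 powr (c * real N)\<close> is \<open>2 powr (real N / (2 * real m))\<close>, the square
    root of the number \<open>2 powr (real N / real m)\<close> that has to be reached.\<close>
  define c where "c = 1 / (2 * real m * real q)"
  have c: "c > 0" using q m by (simp add: c_def)
  have "filterlim (\<lambda>N. 2 powr (real N / (2 * real m))) at_top at_top"
  proof -
    have "real m > 0" using m by simp
    then show ?thesis by real_asymp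
  qed
  then have "\<forall>\<^sub>F N in at_top. 2 powr (real N / (2 * real m)) > 2 ^ (q + 1) * K"
    by (simp add: filterlim_at_top_dense)
  then have "\<forall>\<^sub>F N in at_top. 2 powr (c * real N) \<le> real (d_gen A N)"
  proof eventually_elim
    case (elim N)
    show ?case
    proof (rule ccontr)
      assume "\<not> 2 powr (c * real N) \<le> real (d_gen A N)"
      moreover have "1 \<le> 2 powr (c * real N)" using c by (intro ge_one_powr_ge_zero) auto
      ultimately have less: "real (d_gen A N) + 1 \<le> 2 * 2 powr (c * real N)" by simp
      \<comment> \<open>Rounding \<open>N / m\<close> down costs only a factor 2, already included
        in the constant \<open>2 ^ (q + 1) * K\<close>.\<close>
      have "real N < real m * (real (N div m) + 1)"
        using m by (metis Suc_eq_plus1 add.commute dividend_less_times_div less_le_trans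
            less_one linorder_not_less mult.commute mult_Suc_right of_nat_1 of_nat_add
            of_nat_less_iff of_nat_mult)
      then have "real N / real m \<le> real (N div m) + 1"
        using m by (simp add: field_simps)
      then have "2 powr (real N / real m) \<le> 2 powr (real (N div m) + 1)" by simp
      also have "\<dots> = 2 * 2 ^ (N div m)" by (simp add: powr_add powr_realpow)
      also have "\<dots> \<le> 2 * real q ^ (N div m)"
        using q by (intro mult_left_mono power_mono) auto
      also have "real q ^ (N div m) \<le> (real (d_gen A N) + 1) ^ q * K"
      proof -
        have "real (q ^ (N div m)) \<le> real ((d_gen A N + 1) ^ q * q ^ (q ^ q))"
          using strongly_abelian_image_count[OF assms(1) con sa m, of N]
          unfolding q_def by (rule of_nat_mono)
        then show ?thesis by (simp add: K_def add.commute)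
      qed
      also have "(real (d_gen A N) + 1) ^ q * K \<le> (2 * 2 powr (c * real N)) ^ q * K"
        using less by (intro mult_right_mono power_mono) (auto simp: K_def)
      also have "(2 * 2 powr (c * real N)) ^ q = 2 ^ q * 2 powr (real q * (c * real N))"
        by (simp add: power_mult_distrib powr_power mult.commute)
      also have "real q * (c * real N) = real N / (2 * real m)"
        using q m by (simp add: c_def)
      finally have "2 powr (real N / real m) \<le> 2 ^ (q + 1) * K * 2 powr (real N / (2 * real m))"
        by (simp add: mult_ac)
      also have "\<dots> < 2 powr (real N / (2 * real m)) * 2 powr (real N / (2 * real m))"
        using elim by (intro mult_strict_right_mono) auto
      also have "\<dots> = 2 powr (real N / real m)"
        by (simp add: field_simps flip: powr_add)
      finally show False by simp
    qed
  qed
  then show False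
    using assms(2) c unfolding d_not_exp_iff by blast
qed

subsection \<open>Minimal sets of type 2\<close>

text \<open>Unary polynomials as functions, so that they can be composed and iterated without
  handling syntax.\<close>

definition upoly :: "('a, 'f) alg \<Rightarrow> ('a \<Rightarrow> 'a) \<Rightarrow> bool" where
  "upoly A f \<longleftrightarrow> (\<exists>p. pwf A 1 p \<and> (\<forall>x. f x = pol_app A p [x]))"

text \<open>Only variable 0 matters, so the list \<open>[x]\<close> may be replaced by any
  assignment; in this form \<open>psubst\<close> expresses composition.\<close>

lemma upoly_alt: "upoly A f \<longleftrightarrow> (\<exists>p. pwf A 1 p \<and> (\<forall>s. f (s 0) = peval A s p))"
proof -
  have ev: "pol_app A p [s 0] = peval A s p" if "pwf A 1 p" for p s
    unfolding pol_app_def by (rule peval_cong[OF that]) simp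
  have "(\<forall>x. f x = pol_app A p [x]) \<longleftrightarrow> (\<forall>s. f (s 0) = peval A s p)" if "pwf A 1 p" for p
  proof safe
    fix x assume "\<forall>s. f (s 0) = peval A s p"
    then have "f ((\<lambda>_. x) 0) = peval A (\<lambda>_. x) p" by (rule spec)
    then show "f x = pol_app A p [x]" using ev[OF that, of "\<lambda>_. x"] by simp
  qed (use ev[OF that] in simp)
  then show ?thesis unfolding upoly_def by blast
qed

lemma upolyE:
  assumes "upoly A f"
  obtains p where "pwf A 1 p" "\<And>s. f (s 0) = peval A s p"
proof -
  obtain p where "pwf A 1 p \<and> (\<forall>s. f (s 0) = peval A s p)"
    using assms unfolding upoly_alt by (elim exE) (rule that)
  then show ?thesis using that[of p] by simp
qed

lemma upoly_id: "upoly A (\<lambda>x. x)"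
  unfolding upoly_alt by (intro exI[of _ "PV 0"]) simp

lemma upoly_comp:
  assumes "upoly A f" "upoly A g" shows "upoly A (\<lambda>x. f (g x))"
proof -
  obtain p q where "pwf A 1 p" "\<And>s. f (s 0) = peval A s p"
    "pwf A 1 q" "\<And>s. g (s 0) = peval A s q"
    using upolyE[OF assms(1)] upolyE[OF assms(2)] by metis
  moreover from this have "f (g (s 0)) = peval A s (psubst (\<lambda>_. q) p)" for s
    using \<open>\<And>s. f (s 0) = peval A s p\<close>[of "\<lambda>_. g (s 0)"] by (simp add: peval_psubst)
  ultimately show ?thesis
    unfolding upoly_alt by (intro exI[of _ "psubst (\<lambda>_. q) p"]) (auto intro: pwf_psubst)
qed

lemma upoly_funpow: "upoly A f \<Longrightarrow> upoly A (f ^^ k)"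
proof (induction k)
  case 0
  then show ?case using upoly_id by (simp add: id_def)
next
  case (Suc k)
  then show ?case using upoly_comp[of A f "f ^^ k"] by (simp add: comp_def)
qed

lemma upoly_closed: "is_alg A \<Longrightarrow> upoly A f \<Longrightarrow> x \<in> univ A \<Longrightarrow> f x \<in> univ A"
  unfolding upoly_def pol_app_def by (auto intro!: peval_closed)

lemma con_peval:
  assumes "con A \<theta>" "pwf A m p" "\<And>i. i < m \<Longrightarrow> (s i, s' i) \<in> \<theta>"
  shows "(peval A s p, peval A s' p) \<in> \<theta>"
  using assms(2)
proof (induction p)
  case (PC c)
  then show ?case using assms(1) by (auto simp: con_def equiv_def refl_on_def)
next
  case (PA f ts)
  then have "list_all2 (\<lambda>x y. (x, y) \<in> \<theta>) (map (peval A s) ts) (map (peval A s') ts)"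
    by (auto simp: list_all2_conv_all_nth)
  moreover have "f \<in> sig A" "length (map (peval A s) ts) = ar A f"
    "length (map (peval A s') ts) = ar A f" using PA.prems by auto
  ultimately show ?case using assms(1) unfolding con_def peval.simps by blast
qed (use assms in auto)

lemma con_upoly: "con A \<theta> \<Longrightarrow> upoly A f \<Longrightarrow> (x, y) \<in> \<theta> \<Longrightarrow> (f x, f y) \<in> \<theta>"
  unfolding upoly_def pol_app_def by (auto intro!: con_peval)

lemma con_simps:
  assumes "con A \<theta>"
  shows "x \<in> univ A \<Longrightarrow> (x, x) \<in> \<theta>" "(x, y) \<in> \<theta> \<Longrightarrow> (y, x) \<in> \<theta>"
    "(x, y) \<in> \<theta> \<Longrightarrow> (y, z) \<in> \<theta> \<Longrightarrow> (x, z) \<in> \<theta>" "(x, y) \<in> \<theta> \<Longrightarrow> x \<in> univ A \<and> y \<in> univ A"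
  using assms unfolding con_def equiv_def by (blast dest: refl_onD symD transD)+

lemma upoly_translation:
  assumes "f \<in> sig A" "ar A f = Suc (length us + length vs)" "set us \<subseteq> univ A" "set vs \<subseteq> univ A"
  shows "upoly A (\<lambda>x. opr A f (us @ x # vs))"
  unfolding upoly_def pol_app_def
  by (rule exI[of _ "PA f (map PC us @ PV 0 # map PC vs)"]) (use assms in \<open>auto simp: comp_def\<close>)

text \<open>The pairs of \<open>\<beta>\<close> that every \<open>p \<circ> f\<close> collapses into \<open>\<alpha>\<close> form a congruence between
  \<open>\<alpha>\<close> and \<open>\<beta>\<close>, which must be \<open>\<alpha>\<close>.\<close>
lemma prime_quot_separate:
  assumes A: "is_alg A" and pq: "prime_quot A \<alpha> \<beta>" and p: "upoly A p"
    "(a, b) \<in> \<beta>" "(p a, p b) \<notin> \<alpha>" and xy: "(x, y) \<in> \<beta>" "(x, y) \<notin> \<alpha>"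
  obtains f where "upoly A f" "(p (f x), p (f y)) \<notin> \<alpha>"
proof -
  have con: "con A \<alpha>" "con A \<beta>" "\<alpha> \<subseteq> \<beta>" using pq by (auto simp: prime_quot_def)
  define \<gamma> where "\<gamma> = {(x, y) \<in> \<beta>. \<forall>f. upoly A f \<longrightarrow> (p (f x), p (f y)) \<in> \<alpha>}"
  note cs = con_simps[OF con(1)] con_simps[OF con(2)]
  have "\<alpha> \<subseteq> \<gamma>"
    using con con_upoly[OF con(1) upoly_comp[OF p(1)]] by (auto simp: \<gamma>_def)
  have "equiv (univ A) \<gamma>"
  proof (rule equivI)
    show "\<gamma> \<subseteq> univ A \<times> univ A" using cs(8) by (auto simp: \<gamma>_def)
    show "refl_on (univ A) \<gamma>" using cs(1) \<open>\<alpha> \<subseteq> \<gamma>\<close> by (auto simp: refl_on_def)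
    show "sym \<gamma>" using cs(2,6) unfolding \<gamma>_def by (intro symI) blast
    show "trans \<gamma>" using cs(3,7) unfolding \<gamma>_def by (intro transI) blast
  qed
  moreover have "(opr A f us, opr A f vs) \<in> \<gamma>"
    if f: "f \<in> sig A" "length us = ar A f" "length vs = ar A f"
      "list_all2 (\<lambda>x y. (x, y) \<in> \<gamma>) us vs" for f us vs
  proof -
    have nth: "(us ! i, vs ! i) \<in> \<gamma>" if "i < ar A f" for i
      using f that by (auto simp: list_all2_conv_all_nth)
    have "list_all2 (\<lambda>x y. (x, y) \<in> \<beta>) us vs"
      using f(4) by (rule list_all2_mono) (auto simp: \<gamma>_def)
    then have "(opr A f us, opr A f vs) \<in> \<beta>"
      using con(2) f unfolding con_def by blast
    have "us ! i \<in> univ A \<and> vs ! i \<in> univ A" if "i < ar A f" for i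
      using nth[OF that] cs(8) unfolding \<gamma>_def by blast
    then have inA: "set us \<subseteq> univ A" "set vs \<subseteq> univ A"
      using f(2,3) by (auto simp: in_set_conv_nth)
    have "(p (h (opr A f us)), p (h (opr A f vs))) \<in> \<alpha>" if h: "upoly A h" for h
    proof -
      \<comment> \<open>Arguments are exchanged one at a time; each exchange is a unary translation
        followed by \<open>h\<close>, hence one of the polynomials in the definition of
        \<open>\<gamma>\<close>.\<close>
      have "(p (h (opr A f us)), p (h (opr A f (take k vs @ drop k us)))) \<in> \<alpha>"
        if "k \<le> ar A f" for k
        using that
      proof (induction k)
        case 0
        have "opr A f us \<in> univ A" using A f inA by (auto simp: is_alg_def)
        then have "p (h (opr A f us)) \<in> univ A" using upoly_closed[OF A] p(1) h by blast
        then show ?case using cs(1) by simp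
      next
        case (Suc k)
        define T where "T x = opr A f (take k vs @ x # drop (Suc k) us)" for x
        have "upoly A T"
          unfolding T_def using f(1-3) Suc.prems inA
          by (intro upoly_translation) (auto dest: in_set_takeD in_set_dropD)
        then have "(p (h (T (us ! k))), p (h (T (vs ! k)))) \<in> \<alpha>"
          using nth[of k] Suc.prems upoly_comp[OF h] by (auto simp: \<gamma>_def)
        moreover have "T (us ! k) = opr A f (take k vs @ drop k us)"
          using Suc.prems f by (simp add: T_def Cons_nth_drop_Suc)
        moreover have "T (vs ! k) = opr A f (take (Suc k) vs @ drop (Suc k) us)"
          using Suc.prems f by (simp add: T_def take_Suc_conv_app_nth)
        ultimately show ?case using Suc cs(3) by (metis Suc_leD)
      qed
      from this[of "ar A f"] show ?thesis using f by simp
    qed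
    with \<open>(opr A f us, opr A f vs) \<in> \<beta>\<close> show ?thesis by (simp add: \<gamma>_def)
  qed
  ultimately have "con A \<gamma>" unfolding con_def by blast
  moreover have "\<gamma> \<subset> \<beta>"
    using p(2,3) upoly_id[of A] by (auto simp: \<gamma>_def)
  ultimately have "\<gamma> = \<alpha>" using pq \<open>\<alpha> \<subseteq> \<gamma>\<close> unfolding prime_quot_def by blast
  then have "(x, y) \<notin> \<gamma>" using xy by simp
  then show ?thesis using that xy(1) by (auto simp: \<gamma>_def)
qed

text \<open>Two powers agree on \<open>V\<close> by the pigeonhole principle, and the smaller one is
  cancelled. Then \<open>g ^^ k\<close> is an inverse of \<open>g\<close> on \<open>V\<close>, and
  it is a polynomial whenever \<open>g\<close> is one.\<close>

lemma finite_bij_funpow_id: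
  assumes "finite V" "bij_betw g V V"
  obtains k :: nat where "\<And>x. x \<in> V \<Longrightarrow> (g ^^ Suc k) x = x"
proof -
  have bij: "bij_betw (g ^^ i) V V" for i
    by (induction i) (auto simp: bij_betw_id[unfolded id_def] id_def intro: bij_betw_trans[OF _ assms(2), unfolded comp_def])
  define R where "R i = restrict (g ^^ i) V" for i
  have "R i \<in> V \<rightarrow>\<^sub>E V" for i
    unfolding R_def using bij_betw_imp_funcset[OF bij] by (simp add: restrict_PiE_iff Pi_iff)
  then have "range R \<subseteq> V \<rightarrow>\<^sub>E V" by blast
  then have "finite (range R)"
    using finite_PiE[of V "\<lambda>_. V"] assms(1) finite_subset by blast
  then have "\<not> inj R" using finite_imageD by fastforce
  then obtain i j where ij: "R i = R j" "i < j"
    unfolding inj_on_def by (metis linorder_neqE_nat)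
  obtain k where k: "j = i + Suc k" using ij(2) less_imp_Suc_add by auto
  have "(g ^^ Suc k) x = x" if "x \<in> V" for x
  proof -
    have "(g ^^ i) ((g ^^ Suc k) x) = (g ^^ i) x"
      using ij(1) that unfolding R_def k funpow_add comp_def by (metis restrict_apply')
    moreover have "(g ^^ Suc k) x \<in> V" using bij that by (metis bij_betwE)
    ultimately show ?thesis using bij[of i] that by (metis bij_betw_inv_into_left)
  qed
  then show ?thesis using that by blast
qed

lemma ms_cand_alt:
  "ms_cand A \<alpha> \<beta> V \<longleftrightarrow> (\<exists>p. upoly A p \<and> V = p ` univ A \<and> (\<exists>a b. (a, b) \<in> \<beta> \<and> (p a, p b) \<notin> \<alpha>))"
proof
  assume "ms_cand A \<alpha> \<beta> V"
  then show "\<exists>p. upoly A p \<and> V = p ` univ A \<and> (\<exists>a b. (a, b) \<in> \<beta> \<and> (p a, p b) \<notin> \<alpha>)"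
    unfolding ms_cand_def upoly_def by fast
next
  assume "\<exists>p. upoly A p \<and> V = p ` univ A \<and> (\<exists>a b. (a, b) \<in> \<beta> \<and> (p a, p b) \<notin> \<alpha>)"
  then obtain f p a b where "V = f ` univ A" "(a, b) \<in> \<beta>" "(f a, f b) \<notin> \<alpha>" "pwf A 1 p"
    "f = (\<lambda>x. pol_app A p [x])" unfolding upoly_def by blast
  then show "ms_cand A \<alpha> \<beta> V" unfolding ms_cand_def by blast
qed

section \<open>Minimal sets of a prime quotient\<close>

locale finite_prime_quotient =
  fixes A :: "('a, 'f) alg" and \<alpha> \<beta> :: "('a \<times> 'a) set"
  assumes fin_alg: "fin_alg A" and prime_quot: "prime_quot A \<alpha> \<beta>"
begin

lemma is_alg: "is_alg A" and finite_univ: "finite (univ A)"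
  using fin_alg by (auto simp: fin_alg_def)

lemma con_ab: "con A \<alpha>" "con A \<beta>"
  using prime_quot by (auto simp: prime_quot_def)

lemma min_set_subset: "min_set A \<alpha> \<beta> V \<Longrightarrow> V \<subseteq> univ A"
  unfolding min_set_def ms_cand_alt using upoly_closed[OF is_alg] by auto

lemma min_set_image:
  assumes "min_set A \<alpha> \<beta> V" "upoly A h" "h ` univ A \<subseteq> V" "(a, b) \<in> \<beta>" "(h a, h b) \<notin> \<alpha>"
  shows "h ` univ A = V"
proof -
  have "ms_cand A \<alpha> \<beta> (h ` univ A)" using assms unfolding ms_cand_alt by blast
  with assms(1,3) show ?thesis unfolding min_set_def by blast
qed

text \<open>A pair that \<open>p\<close> keeps apart can be separated once more through
  \<open>p\<close>, giving \<open>g = p f\<close> with \<open>g\<close> nonconstant modulo \<alpha>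
  on \<open>V\<close>. Minimality makes \<open>g\<close> a permutation of \<open>V\<close>, and a
  suitable power of it is a retraction of the algebra onto \<open>V\<close>.\<close>

lemma min_set_idempotent:
  assumes V: "min_set A \<alpha> \<beta> V"
  obtains e x y where "upoly A e" "e ` univ A = V" "\<And>v. v \<in> V \<Longrightarrow> e v = v"
    "x \<in> V" "y \<in> V" "(x, y) \<in> \<beta>" "(x, y) \<notin> \<alpha>"
proof -
  obtain p a b where p: "upoly A p" "V = p ` univ A" "(a, b) \<in> \<beta>" "(p a, p b) \<notin> \<alpha>"
    using V unfolding min_set_def ms_cand_alt by blast
  have pab: "(p a, p b) \<in> \<beta>" by (rule con_upoly[OF con_ab(2) p(1,3)])
  obtain f where f: "upoly A f" "(p (f (p a)), p (f (p b))) \<notin> \<alpha>"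
    using prime_quot_separate[OF is_alg prime_quot p(1,3,4) pab p(4)] by blast
  define g where "g x = p (f x)" for x
  have g: "upoly A g" unfolding g_def[abs_def] by (rule upoly_comp[OF p(1) f(1)])
  have gV: "g x \<in> V" if "x \<in> univ A" for x
    using upoly_closed[OF is_alg f(1) that] p(2) by (auto simp: g_def)
  have "(\<lambda>x. g (p x)) ` univ A = V"
    by (rule min_set_image[OF V upoly_comp[OF g p(1)] _ p(3)])
      (use gV upoly_closed[OF is_alg p(1)] f(2) in \<open>auto simp: g_def\<close>)
  then have "g ` V = V" by (simp add: p(2) image_image)
  moreover have fV: "finite V" using p(2) finite_univ by simp
  ultimately have "bij_betw g V V" by (simp add: bij_betw_def eq_card_imp_inj_on)
  then obtain k where k: "\<And>x. x \<in> V \<Longrightarrow> (g ^^ Suc k) x = x"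
    using finite_bij_funpow_id fV by metis
  define e where "e = g ^^ Suc k"
  have e: "upoly A e" unfolding e_def by (rule upoly_funpow[OF g])
  have "e x \<in> V" if "x \<in> univ A" for x
    unfolding e_def using gV upoly_closed[OF is_alg upoly_funpow[OF g] that] by simp
  then have "e ` univ A = V" using k min_set_subset[OF V] unfolding e_def by force
  moreover have "a \<in> univ A" "b \<in> univ A" using con_simps(4)[OF con_ab(2) p(3)] by auto
  ultimately show ?thesis using that[of e "p a" "p b"] e k p pab by (auto simp: e_def)
qed

text \<open>Precomposing \<open>f\<close> with the retraction onto \<open>V\<close> gives a
  polynomial of the whole algebra with image inside \<open>V\<close>; minimality forces the image to
  be all of \<open>V\<close>.\<close>

lemma min_set_permutation:
  assumes V: "min_set A \<alpha> \<beta> V" and f: "upoly A f" "f ` V \<subseteq> V"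
    and xy: "x \<in> V" "y \<in> V" "(x, y) \<in> \<beta>" "(f x, f y) \<notin> \<alpha>"
  shows "bij_betw f V V"
proof -
  obtain e where e: "upoly A e" "e ` univ A = V" "\<And>v. v \<in> V \<Longrightarrow> e v = v"
    by (rule min_set_idempotent[OF V]) (rule that)
  have eV: "e t \<in> V" if "t \<in> univ A" for t using e(2) that by blast
  have "(\<lambda>x. f (e x)) ` univ A = V"
  proof (rule min_set_image[OF V upoly_comp[OF f(1) e(1)] _ xy(3)])
    show "(\<lambda>x. f (e x)) ` univ A \<subseteq> V" using eV f(2) by blast
    show "(f (e x), f (e y)) \<notin> \<alpha>" using e(3) xy by simp
  qed
  then have "f ` V = V" using e(2) by (metis image_image)
  moreover have "finite V" using min_set_subset[OF V] finite_univ finite_subset by blast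
  ultimately show ?thesis by (simp add: bij_betw_def eq_card_imp_inj_on)
qed

lemma min_set_surjection:
  assumes V: "min_set A \<alpha> \<beta> V" and W: "min_set A \<alpha> \<beta> W"
  obtains h where "upoly A h" "h ` V = W"
proof -
  obtain e x y where e: "upoly A e" "e ` univ A = V" "\<And>v. v \<in> V \<Longrightarrow> e v = v"
    "x \<in> V" "y \<in> V" "(x, y) \<in> \<beta>" "(x, y) \<notin> \<alpha>"
    by (rule min_set_idempotent[OF V]) (rule that)
  obtain p a b where p: "upoly A p" "W = p ` univ A" "(a, b) \<in> \<beta>" "(p a, p b) \<notin> \<alpha>"
    using W unfolding min_set_def ms_cand_alt by blast
  obtain f where f: "upoly A f" "(p (f x), p (f y)) \<notin> \<alpha>"
    using prime_quot_separate[OF is_alg prime_quot p(1,3,4) e(6,7)] by blast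
  have u: "upoly A (\<lambda>x. p (f x))" by (rule upoly_comp[OF p(1) f(1)])
  have "(\<lambda>x. p (f (e x))) ` univ A = W"
  proof (rule min_set_image[OF W upoly_comp[OF u e(1)] _ e(6)])
    show "(\<lambda>x. p (f (e x))) ` univ A \<subseteq> W"
      using upoly_closed[OF is_alg f(1)] upoly_closed[OF is_alg e(1)] p(2) by blast
    show "(p (f (e x)), p (f (e y))) \<notin> \<alpha>" using e(3-5) f(2) by simp
  qed
  then have "(\<lambda>x. p (f x)) ` V = W" using e(2) by (metis (no_types) image_image)
  with u that show ?thesis by blast
qed

text \<open>\<open>typ2\<close> supplies a type 2 trace in just one minimal set, so unitality has to
  be carried to the others. With \<open>g\<close> a left inverse of \<open>h\<close> on
  \<open>V\<close>, the operation \<open>h (q (g x, g y))\<close> has the neutral element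
  \<open>h z\<close> on \<open>W\<close>.\<close>

lemma unital_poly_min_sets:
  assumes V: "min_set A \<alpha> \<beta> V" and W: "min_set A \<alpha> \<beta> W" and "unital_poly A V"
  shows "unital_poly A W"
proof -
  obtain h where h: "upoly A h" "h ` V = W" using min_set_surjection[OF V W] .
  obtain h' where h': "upoly A h'" "h' ` W = V" using min_set_surjection[OF W V] .
  have fV: "finite V" using min_set_subset[OF V] finite_univ finite_subset by blast
  \<comment> \<open>The round trip permutes \<open>V\<close>; correcting \<open>h'\<close> by the
    power \<open>c ^^ k\<close> turns it into the left inverse \<open>g\<close> of
    \<open>h\<close>.\<close>
  define c where "c x = h' (h x)" for x
  have "c ` V = V" using h h' by (auto simp: c_def image_image[symmetric])
  then have "bij_betw c V V" using fV by (simp add: bij_betw_def eq_card_imp_inj_on)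
  then obtain k where k: "\<And>x. x \<in> V \<Longrightarrow> (c ^^ Suc k) x = x"
    using finite_bij_funpow_id fV by metis
  define g where "g x = (c ^^ k) (h' x)" for x
  have "upoly A c" unfolding c_def[abs_def] by (rule upoly_comp[OF h'(1) h(1)])
  then have g: "upoly A g"
    unfolding g_def[abs_def] by (rule upoly_comp[OF upoly_funpow h'(1)])
  have gh: "g (h v) = v" if "v \<in> V" for v
    using k[OF that] unfolding funpow_Suc_right by (simp add: g_def c_def)
  obtain q z where q: "z \<in> V" "pwf A 2 q"
    "\<And>x. x \<in> V \<Longrightarrow> pol_app A q [x, z] = x \<and> pol_app A q [z, x] = x"
    using assms(3) by (auto simp: unital_poly_def)
  obtain ph pg where ph: "pwf A 1 ph" "\<And>s. h (s 0) = peval A s ph"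
    and pg: "pwf A 1 pg" "\<And>s. g (s 0) = peval A s pg"
    using upolyE[OF h(1)] upolyE[OF g] by metis
  define q' where "q' = psubst (\<lambda>_. psubst (\<lambda>i. psubst (\<lambda>_. PV i) pg) q) ph"
  have "pwf A 2 q'"
    unfolding q'_def by (intro pwf_psubst[OF ph(1)] pwf_psubst[OF q(2)] pwf_psubst[OF pg(1)]) auto
  moreover have "pol_app A q' [x, y] = h (pol_app A q [g x, g y])" for x y
  proof -
    have "pol_app A q' [x, y] = h (peval A (\<lambda>i. g ([x, y] ! i)) q)"
      unfolding pol_app_def q'_def peval_psubst by (simp add: flip: ph(2) pg(2))
    also have "peval A (\<lambda>i. g ([x, y] ! i)) q = pol_app A q [g x, g y]"
      unfolding pol_app_def by (rule peval_cong[OF q(2)]) (auto simp: less_2_cases_iff)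
    finally show ?thesis .
  qed
  ultimately show ?thesis
    unfolding unital_poly_def using q h(2) gh by (intro exI[of _ q'] bexI[of _ "h z"]) auto
qed

text \<open>\<open>trace_type2\<close> is read from right to left: vector addition is affine with
  coefficients 1, 1 and constant 0, so some polynomial induces it modulo \<alpha>. Any
  representative \<open>z\<close> of the zero class is then neutral up to \<alpha>.\<close>

lemma type2_addition:
  assumes N: "N \<subseteq> univ A" and "trace_type2 A \<alpha> N"
  obtains p z where "pwf A 2 p" "z \<in> N"
    "\<And>x y. x \<in> N \<Longrightarrow> y \<in> N \<Longrightarrow> pol_app A p [x, y] \<in> N"
    "\<And>x y. x \<in> N \<Longrightarrow> y \<in> N \<Longrightarrow> (y, z) \<in> \<alpha> \<Longrightarrow> (pol_app A p [x, y], x) \<in> \<alpha>"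
    "\<And>x y. x \<in> N \<Longrightarrow> y \<in> N \<Longrightarrow> (y, z) \<in> \<alpha> \<Longrightarrow> (pol_app A p [y, x], x) \<in> \<alpha>"
proof -
  define cls where "cls x = \<alpha> `` {x} \<inter> N" for x
  define Q where "Q = cls ` N"
  note cs = con_simps[OF con_ab(1)]
  have cls_eq: "cls x = cls y \<longleftrightarrow> (x, y) \<in> \<alpha>" if "x \<in> N" "y \<in> N" for x y
    unfolding cls_def using that N cs by blast
  obtain K :: "nat ring" and W :: "(nat, 'a set) module" where
    KW: "field K \<and> Module.module K W \<and> carrier W = Q \<and>
       (\<forall>n (g :: 'a set list \<Rightarrow> 'a set).
          (\<exists>p. pwf A n p \<and> (\<forall>xs\<in>tuples N n. pol_app A p xs \<in> N) \<and>
               (\<forall>xs\<in>tuples N n. g (map cls xs) = cls (pol_app A p xs)))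
          \<longleftrightarrow>
          (\<exists>ks c. length ks = n \<and> set ks \<subseteq> carrier K \<and> c \<in> Q \<and>
               (\<forall>qs\<in>tuples Q n.
                  g qs = finsum W (\<lambda>i. (ks ! i) \<odot>\<^bsub>W\<^esub> (qs ! i)) {..<n} \<oplus>\<^bsub>W\<^esub> c)))"
    using assms(2) unfolding trace_type2_def Let_def cls_def[symmetric] Q_def[symmetric]
    by (elim exE) (rule that)
  then have K: "field K" and W: "Module.module K W" "carrier W = Q" by blast+
  interpret W: Module.module K W by (rule W)
  interpret K: field K by (rule K)
  define g where "g qs = qs ! 0 \<oplus>\<^bsub>W\<^esub> qs ! 1" for qs :: "'a set list"
  have "g qs = finsum W (\<lambda>i. ([\<one>\<^bsub>K\<^esub>, \<one>\<^bsub>K\<^esub>] ! i) \<odot>\<^bsub>W\<^esub> (qs ! i)) {..<2} \<oplus>\<^bsub>W\<^esub> \<zero>\<^bsub>W\<^esub>"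
    if "qs \<in> tuples Q 2" for qs
  proof -
    have "qs ! 0 \<in> carrier W" "qs ! 1 \<in> carrier W" using that W(2) by (auto simp: tuples_iff)
    moreover have "{..<2} = {0, 1 :: nat}" by auto
    ultimately show ?thesis by (simp add: g_def W.a_comm)
  qed
  moreover have "\<zero>\<^bsub>W\<^esub> \<in> Q" using W(2) W.zero_closed by simp
  ultimately have "\<exists>ks c. length ks = 2 \<and> set ks \<subseteq> carrier K \<and> c \<in> Q \<and>
      (\<forall>qs\<in>tuples Q 2.
        g qs = finsum W (\<lambda>i. (ks ! i) \<odot>\<^bsub>W\<^esub> (qs ! i)) {..<2} \<oplus>\<^bsub>W\<^esub> c)"
    by (intro exI[of _ "[\<one>\<^bsub>K\<^esub>, \<one>\<^bsub>K\<^esub>]"] exI[of _ "\<zero>\<^bsub>W\<^esub>"]) simp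
  then have "\<exists>p. pwf A 2 p \<and> (\<forall>xs\<in>tuples N 2. pol_app A p xs \<in> N) \<and>
      (\<forall>xs\<in>tuples N 2. g (map cls xs) = cls (pol_app A p xs))"
    using KW by blast
  then obtain p where p: "pwf A 2 p" "\<And>xs. xs \<in> tuples N 2 \<Longrightarrow> pol_app A p xs \<in> N"
    "\<And>xs. xs \<in> tuples N 2 \<Longrightarrow> g (map cls xs) = cls (pol_app A p xs)"
    by blast
  have pN: "pol_app A p [x, y] \<in> N" "cls (pol_app A p [x, y]) = cls x \<oplus>\<^bsub>W\<^esub> cls y"
    if "x \<in> N" "y \<in> N" for x y
    using p(2,3)[of "[x, y]"] that by (auto simp: g_def tuples_def)
  obtain z where z: "z \<in> N" "cls z = \<zero>\<^bsub>W\<^esub>"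
    using W.zero_closed W(2) unfolding Q_def by force
  have clsW: "cls x \<in> carrier W" if "x \<in> N" for x using that W(2) by (simp add: Q_def)
  have "(pol_app A p [x, y], x) \<in> \<alpha>" "(pol_app A p [y, x], x) \<in> \<alpha>"
    if "x \<in> N" "y \<in> N" "(y, z) \<in> \<alpha>" for x y
  proof -
    have "cls y = \<zero>\<^bsub>W\<^esub>" using that z cls_eq by metis
    then show "(pol_app A p [x, y], x) \<in> \<alpha>" "(pol_app A p [y, x], x) \<in> \<alpha>"
      using pN that clsW cls_eq by (metis W.r_zero W.l_zero)+
  qed
  with that[OF p(1) z(1)] pN show ?thesis by blast
qed

text \<open>Neutrality of \<open>z\<close> holds at first only on \<open>N\<close> and only modulo
  \<alpha>. The translations by \<open>z\<close> on either side nevertheless keep the pair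
  \<open>u\<close>, \<open>w\<close> of the trace apart, so they permute all of \<open>V\<close>,
  and undoing them makes \<open>z\<close> exactly neutral on \<open>V\<close>.\<close>

lemma type2_unital:
  assumes V: "min_set A \<alpha> \<beta> V" and tr: "is_trace \<alpha> \<beta> V N" and "trace_type2 A \<alpha> N"
  shows "unital_poly A V"
proof -
  note cs = con_simps[OF con_ab(1)]
  note VA = min_set_subset[OF V]
  then have fV: "finite V" using finite_univ finite_subset by blast
  obtain b where N: "N = V \<inter> \<beta> `` {b}" using tr by (auto simp: is_trace_def)
  then have NV: "N \<subseteq> V" and NA: "N \<subseteq> univ A" using VA by auto
  obtain u w where uw: "u \<in> N" "w \<in> N" "(u, w) \<notin> \<alpha>" using tr by (auto simp: is_trace_def)
  then have uwb: "(u, w) \<in> \<beta>" using N con_simps[OF con_ab(2)] by blast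
  obtain e where e: "upoly A e" "e ` univ A = V" "\<And>v. v \<in> V \<Longrightarrow> e v = v"
    by (rule min_set_idempotent[OF V]) (rule that)
  obtain p z where p: "pwf A 2 p" and z: "z \<in> N" and
    pN: "\<And>x y. x \<in> N \<Longrightarrow> y \<in> N \<Longrightarrow> pol_app A p [x, y] \<in> N" and
    pl: "\<And>x y. x \<in> N \<Longrightarrow> y \<in> N \<Longrightarrow> (y, z) \<in> \<alpha> \<Longrightarrow> (pol_app A p [x, y], x) \<in> \<alpha>" and
    pr: "\<And>x y. x \<in> N \<Longrightarrow> y \<in> N \<Longrightarrow> (y, z) \<in> \<alpha> \<Longrightarrow> (pol_app A p [y, x], x) \<in> \<alpha>"
    using type2_addition[OF NA assms(3)] by metis
  have zA: "z \<in> univ A" and zz: "(z, z) \<in> \<alpha>" using z NA cs(1) by auto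
  \<comment> \<open>Retracting by \<open>e\<close> brings all sums of elements of \<open>V\<close>
    back into \<open>V\<close> and changes nothing on \<open>N\<close>.\<close>
  define s where "s x y = e (pol_app A p [x, y])" for x y
  obtain pe where pe: "pwf A 1 pe" "\<And>s. e (s 0) = peval A s pe"
    using upolyE[OF e(1)] by metis
  define ps where "ps = psubst (\<lambda>_. p) pe"
  have ps: "pwf A 2 ps" unfolding ps_def by (rule pwf_psubst[OF pe(1)]) (rule p)
  have ps2: "peval A t ps = s (t 0) (t 1)" for t
  proof -
    have "peval A t ps = e (peval A t p)"
      unfolding ps_def peval_psubst by (simp flip: pe(2))
    also have "peval A t p = pol_app A p [t 0, t 1]"
      unfolding pol_app_def by (rule peval_cong[OF p]) (auto simp: less_2_cases_iff)
    finally show ?thesis by (simp add: s_def)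
  qed
  have s_poly: "upoly A (\<lambda>x. s (f x) (g x))" if fg: "upoly A f" "upoly A g" for f g
  proof -
    obtain pf pg where "pwf A 1 pf" "\<And>t. f (t 0) = peval A t pf"
      "pwf A 1 pg" "\<And>t. g (t 0) = peval A t pg"
      using upolyE[OF fg(1)] upolyE[OF fg(2)] by metis
    then show ?thesis
      unfolding upoly_alt
      by (intro exI[of _ "psubst (\<lambda>i. if i = 0 then pf else pg) ps"] conjI pwf_psubst[OF ps])
        (auto simp: peval_psubst ps2)
  qed
  have const: "upoly A (\<lambda>_. c)" if "c \<in> univ A" for c
    unfolding upoly_alt by (rule exI[of _ "PC c"]) (use that in simp)
  have sV: "s x y \<in> V" if "x \<in> V" "y \<in> V" for x y
  proof -
    have "pol_app A p [x, y] \<in> univ A"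
      unfolding pol_app_def
      by (rule peval_closed[OF is_alg p]) (use that VA in \<open>auto simp: less_2_cases_iff\<close>)
    then show ?thesis using e(2) by (auto simp: s_def)
  qed
  have sN: "s x y = pol_app A p [x, y]" if "x \<in> N" "y \<in> N" for x y
    using pN[OF that] NV e(3) by (auto simp: s_def)
  \<comment> \<open>A map that moves elements of \<open>N\<close> only inside their \<alpha>-classes
    does not collapse the pair \<open>u\<close>, \<open>w\<close>, as the permutation criterion
    demands.\<close>
  have notin: "(f u, f w) \<notin> \<alpha>" if "\<And>x. x \<in> N \<Longrightarrow> (f x, x) \<in> \<alpha>" for f
    using that uw cs by meson
  define f1 where "f1 x = s x z" for x
  have f1: "upoly A f1" "f1 ` V \<subseteq> V"
    using s_poly[OF upoly_id const[OF zA]] sV z NV by (auto simp: f1_def[abs_def])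
  have f1N: "f1 x \<in> N" "(f1 x, x) \<in> \<alpha>" if "x \<in> N" for x
    using that z pN pl zz by (auto simp: f1_def sN)
  have "bij_betw f1 V V"
    by (rule min_set_permutation[OF V f1 _ _ uwb notin[OF f1N(2)]]) (use uw NV in auto)
  then obtain k1 where k1: "\<And>x. x \<in> V \<Longrightarrow> (f1 ^^ Suc k1) x = x"
    using finite_bij_funpow_id fV by metis
  \<comment> \<open>The inverse of \<open>f1\<close> on \<open>V\<close>. It also stays inside
    \<alpha>-classes on \<open>N\<close>, so inserting it leaves the left translation by
    \<open>z\<close> congruent to the identity there.\<close>
  define \<sigma> where "\<sigma> = f1 ^^ k1"
  have \<sigma>: "upoly A \<sigma>" unfolding \<sigma>_def by (rule upoly_funpow[OF f1(1)])
  have \<sigma>N: "\<sigma> x \<in> N \<and> (\<sigma> x, x) \<in> \<alpha>" if "x \<in> N" for x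
    unfolding \<sigma>_def
  proof (induction k1)
    case 0
    then show ?case using that NA cs(1) by auto
  next
    case (Suc k)
    then show ?case using f1N[of "(f1 ^^ k) x"] cs(3) by auto
  qed
  have \<sigma>V: "\<sigma> x \<in> V" if "x \<in> V" for x
    unfolding \<sigma>_def using that f1(2) by (induction k1) auto
  define s1 where "s1 x y = s (\<sigma> x) y" for x y
  have s1: "s1 x z = x" if "x \<in> V" for x
    using k1[OF that] by (simp add: s1_def \<sigma>_def f1_def)
  define f2 where "f2 y = s1 z y" for y
  have \<sigma>z: "\<sigma> z \<in> univ A" using \<sigma>N[OF z] NA by auto
  have f2: "upoly A f2" "f2 ` V \<subseteq> V"
    using s_poly[OF const[OF \<sigma>z] upoly_id] sV \<sigma>V z NV by (auto simp: f2_def[abs_def] s1_def)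
  have f2N: "(f2 y, y) \<in> \<alpha>" if "y \<in> N" for y
    using that \<sigma>N[OF z] pr by (auto simp: f2_def s1_def sN)
  have "bij_betw f2 V V"
    by (rule min_set_permutation[OF V f2 _ _ uwb notin[OF f2N]]) (use uw NV in auto)
  then obtain k2 where k2: "\<And>x. x \<in> V \<Longrightarrow> (f2 ^^ Suc k2) x = x"
    using finite_bij_funpow_id fV by metis
  define \<tau> where "\<tau> = f2 ^^ k2"
  have \<tau>: "upoly A \<tau>" unfolding \<tau>_def by (rule upoly_funpow[OF f2(1)])
  have "f2 z = z" using s1 z NV by (auto simp: f2_def)
  \<comment> \<open>Since \<open>\<tau>\<close> fixes \<open>z\<close>, the correction in the second
    argument does not spoil the neutrality gained in the first.\<close>
  then have \<tau>z: "\<tau> z = z" unfolding \<tau>_def by (induction k2) auto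
  have \<tau>V: "s1 z (\<tau> y) = y" if "y \<in> V" for y
    using k2[OF that] by (simp add: \<tau>_def f2_def)
  obtain p\<sigma> p\<tau> where p\<sigma>: "pwf A 1 p\<sigma>" "\<And>t. \<sigma> (t 0) = peval A t p\<sigma>"
    and p\<tau>: "pwf A 1 p\<tau>" "\<And>t. \<tau> (t 0) = peval A t p\<tau>"
    using upolyE[OF \<sigma>] upolyE[OF \<tau>] by metis
  define q where "q = psubst (\<lambda>i. if i = 0 then p\<sigma> else psubst (\<lambda>_. PV 1) p\<tau>) ps"
  have "pwf A 2 q"
  proof -
    have "pwf A 2 p\<sigma>" using pwf_psubst[OF p\<sigma>(1), of 2 PV] by (simp add: psubst_PV)
    moreover have "pwf A 2 (psubst (\<lambda>_. PV 1) p\<tau>)" by (rule pwf_psubst[OF p\<tau>(1)]) simp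
    ultimately show ?thesis unfolding q_def by (intro pwf_psubst[OF ps]) auto
  qed
  moreover have "pol_app A q [x, y] = s1 x (\<tau> y)" for x y
    unfolding pol_app_def q_def peval_psubst ps2 s1_def
    by (simp add: peval_psubst flip: p\<sigma>(2) p\<tau>(2))
  ultimately show ?thesis
    unfolding unital_poly_def using s1 \<tau>V \<tau>z z NV
    by (intro exI[of _ q] bexI[of _ z]) auto
qed

end

lemma type2_minimal_set_unital:
  assumes "fin_alg A" "V \<in> type2_minimal_sets A"
  shows "V \<subseteq> univ A \<and> unital_poly A V"
proof -
  obtain \<alpha> \<beta> V' N where *: "prime_quot A \<alpha> \<beta>" "min_set A \<alpha> \<beta> V" "min_set A \<alpha> \<beta> V'"
    "is_trace \<alpha> \<beta> V' N" "trace_type2 A \<alpha> N"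
    using assms(2) by (auto simp: type2_minimal_sets_def typ2_def)
  interpret finite_prime_quotient A \<alpha> \<beta>
    using assms(1) *(1) by unfold_locales
  show ?thesis
    using min_set_subset[OF *(2)] unital_poly_min_sets[OF *(3,2) type2_unital[OF *(3-5)]] by blast
qed

lemma spread_of_type2_imp_d_linear:
  assumes "fin_alg A" "spread_of_type2 A" shows "d_linear A"
  using spread_unital_imp_d_linear[OF assms(1)] assms type2_minimal_set_unital
  unfolding spread_of_type2_def by blast

subsection \<open>Counterexamples\<close>

lemma length_2_conv: "length xs = 2 \<longleftrightarrow> (\<exists>x y. xs = [x, y])"
  by (auto simp: numeral_2_eq_2 length_Suc_conv)

lemma length_3_conv: "length xs = 3 \<longleftrightarrow> (\<exists>x y z. xs = [x, y, z])"
  by (auto simp: numeral_3_eq_3 length_Suc_conv)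

section \<open>(vi) without (v): a semilattice with bottom 0 and two atoms 1, 2\<close>

definition flat_semilattice :: "(nat, nat) alg" where
  "flat_semilattice = \<lparr> univ = {0, 1, 2}, sig = {0}, ar = (\<lambda>_. 2),
     opr = (\<lambda>_ xs. if xs ! 0 = xs ! 1 then xs ! 0 else 0) \<rparr>"

lemma flat_semilattice_sel [simp]:
  "univ flat_semilattice = {0, 1, 2}" "sig flat_semilattice = {0}" "ar flat_semilattice f = 2"
  "opr flat_semilattice f xs = (if xs ! 0 = xs ! 1 then xs ! 0 else 0)"
  by (simp_all add: flat_semilattice_def)

lemma fin_alg_flat_semilattice: "fin_alg flat_semilattice"
  by (auto simp: fin_alg_def is_alg_def length_2_conv)

text \<open>A meet without zero entries equals both of its arguments, so all \<open>2 ^ n\<close>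
  tuples over the atoms are irreducible.\<close>

lemma flat_semilattice_exp: "\<not> d_not_exp flat_semilattice"
proof -
  have "2 ^ n \<le> d_gen flat_semilattice n" for n
  proof -
    have "card (tuples {1, 2 :: nat} n) \<le> d_gen flat_semilattice n"
    proof (rule d_gen_ge_card_irreducible[OF fin_alg_flat_semilattice])
      show "tuples {1, 2} n \<subseteq> tuples (univ flat_semilattice) n" by (auto simp: tuples_def)
      fix z f xs
      assume z: "z \<in> tuples {1, 2 :: nat} n" and "length xs = ar flat_semilattice f"
        and xs: "set xs \<subseteq> tuples (univ flat_semilattice) n"
        and eq: "opr (pow flat_semilattice n) f xs = z"
      then obtain x y where xy: "xs = [x, y]" by (auto simp: length_2_conv)
      have "x ! i = z ! i" if "i < n" for i
      proof -
        have "z ! i = (if x ! i = y ! i then x ! i else 0)"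
          using that eq by (auto simp: xy)
        moreover have "z ! i \<noteq> 0" using z that by (auto simp: tuples_iff)
        ultimately show ?thesis by (auto split: if_splits)
      qed
      then have "x = z"
        using z xs by (intro nth_equalityI) (auto simp: xy tuples_iff)
      then show "z \<in> set xs" by (simp add: xy)
    qed
    then show ?thesis by (simp add: card_tuples numeral_2_eq_2)
  qed
  then have "2 powr (1 * real n) \<le> real (d_gen flat_semilattice n)" for n
    by (metis mult_1 of_nat_le_iff of_nat_numeral of_nat_power powr_realpow zero_less_numeral)
  then show ?thesis
    unfolding d_not_exp_iff by (auto intro!: exI[of _ 1])
qed

text \<open>Commutativity \<open>m X Y = m Y X\<close> feeds the strong term condition, which yields
  \<open>m Z Y = m Z X\<close> for every \<open>Z\<close>. Taking \<open>Z\<close> as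
  \<open>X\<close> and as \<open>Y\<close>, idempotence gives \<open>X = m X Y = Y\<close>.\<close>

lemma flat_semilattice_no_sa_image: "no_sa_image flat_semilattice"
  unfolding no_sa_image_def
proof (intro allI impI notI)
  fix n \<theta>
  let ?P = "pow flat_semilattice n"
  let ?Q = "quot ?P \<theta>"
  assume con: "con ?P \<theta>" and
    "(\<exists>x\<in>univ ?Q. \<exists>y\<in>univ ?Q. x \<noteq> y) \<and> strongly_abelian ?Q"
  then obtain X Y where XY: "X \<in> univ ?Q" "Y \<in> univ ?Q" "X \<noteq> Y" and sa: "strongly_abelian ?Q"
    by blast
  define m where "m X Y = opr ?Q 0 [X, Y]" for X Y
  obtain x y where xy: "x \<in> univ ?P" "X = \<theta> `` {x}" "y \<in> univ ?P" "Y = \<theta> `` {y}"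
    using XY(1,2) unfolding quot_sel by (metis quotientE)
  have m: "m (\<theta> `` {u}) (\<theta> `` {v}) = \<theta> `` {opr ?P 0 [u, v]}"
    if "u \<in> univ ?P" "v \<in> univ ?P" for u v
    using quot_opr[OF con, of 0 "[u, v]"] that by (simp add: m_def del: pow_sel(4))
  have comm: "opr ?P 0 [x, y] = opr ?P 0 [y, x]" by auto
  have idem: "opr ?P 0 [u, u] = u" if "u \<in> univ ?P" for u
    using that by (auto simp: tuples_def intro!: nth_equalityI)
  have "m X Y = m Y X" "m X X = X" "m Y Y = Y"
    using xy m idem comm by (simp_all del: pow_sel)
  define t :: "(nat, nat list set) ptrm" where "t = PA 0 [PV 0, PV 1]"
  have t: "is_term ?Q (1 + 1) t" by (auto simp: t_def is_term_def)
  have ev: "pol_app ?Q t ([U] @ [V]) = m U V" for U V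
    by (simp add: t_def pol_app_def m_def)
  have "m Z Y = m Z X" if "Z \<in> univ ?Q" for Z
    using sa[unfolded strongly_abelian_def, rule_format, OF t, of "[X]" "[Y]" "[Z]" "[Y]" "[X]"]
      XY(1,2) that \<open>m X Y = m Y X\<close> unfolding ev by (auto simp: tuples_def)
  from this[of X] this[of Y] show False
    using XY \<open>m X Y = m Y X\<close> \<open>m X X = X\<close> \<open>m Y Y = Y\<close> by metis
qed

section \<open>(ii), and hence (v), without (iv): a pointed 3-cube operation\<close>

text \<open>The operation is prescribed by the three identities F(x,x,1) = F(x,1,x) = F(1,x,x) = x
  and is 0 wherever none of them applies; few values other than 0 mean many irreducible
  tuples.\<close>

definition pointed_alg :: "(nat, nat) alg" where
  "pointed_alg = \<lparr> univ = {0, 1, 2}, sig = {0}, ar = (\<lambda>_. 3),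
     opr = (\<lambda>_ xs. if xs ! 0 = xs ! 1 \<and> xs ! 2 = 1 then xs ! 0
       else if xs ! 0 = xs ! 2 \<and> xs ! 1 = 1 then xs ! 0
       else if xs ! 1 = xs ! 2 \<and> xs ! 0 = 1 then xs ! 1 else 0) \<rparr>"

lemma pointed_alg_sel [simp]:
  "univ pointed_alg = {0, 1, 2}" "sig pointed_alg = {0}" "ar pointed_alg f = 3"
  by (simp_all add: pointed_alg_def)

lemma opr_pointed_alg:
  "opr pointed_alg f [x, y, z] = (if x = y \<and> z = 1 then x else if x = z \<and> y = 1 then x
     else if y = z \<and> x = 1 then y else 0)"
  by (simp add: pointed_alg_def)

lemma opr_pointed_alg_cube:
  "opr pointed_alg f [x, x, 1] = x" "opr pointed_alg f [x, 1, x] = x" "opr pointed_alg f [1, x, x] = x"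
  unfolding opr_pointed_alg by (cases "x = 1"; simp)+

lemma opr_pointed_alg_eq_1:
  assumes "opr pointed_alg f [x, y, z] = 1" shows "x = 1 \<and> y = 1 \<and> z = 1"
  using assms unfolding opr_pointed_alg by (simp split: if_split_asm)

lemma opr_pointed_alg_eq_2:
  assumes "opr pointed_alg f [x, y, z] = 2"
  shows "(x = 2 \<and> y = 2) \<or> (x = 2 \<and> z = 2) \<or> (y = 2 \<and> z = 2)"
  using assms unfolding opr_pointed_alg by (simp split: if_split_asm)

lemma fin_alg_pointed_alg: "fin_alg pointed_alg"
proof -
  have "opr pointed_alg f [x, y, z] \<in> univ pointed_alg"
    if "x \<in> univ pointed_alg" "y \<in> univ pointed_alg" for f x y z
  proof -
    have "0 \<in> univ pointed_alg" by simp
    with that show ?thesis unfolding opr_pointed_alg by ((split if_split)+, blast)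
  qed
  then show ?thesis
    by (auto simp: fin_alg_def is_alg_def length_3_conv simp del: pointed_alg_sel(1)) simp_all
qed

lemma pointed_alg_cube: "has_pointed_cube_poly pointed_alg"
proof -
  \<comment> \<open>The constant 1 stands on the antidiagonal, so the rows are x, x, 1 and x, 1, x
    and 1, x, x.\<close>
  define M :: "nat \<Rightarrow> nat \<Rightarrow> nat cell" where "M i j = (if i + j = 2 then CC 1 else CV 0)" for i j
  have "\<exists>i<3. M i j \<noteq> CV 0" if "j < 3" for j
    using that by (intro exI[of _ "2 - j"]) (auto simp: M_def)
  moreover have "pol_app pointed_alg (PA 0 [PV 0, PV 1, PV 2])
      (map (\<lambda>j. cell_val s (M i j)) [0..<3]) = s 0" if "i < 3" for i s
  proof -
    have upt: "[0..<3] = [0, 1, 2]" by (simp add: upt_rec)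
    have "i = 0 \<or> i = 1 \<or> i = 2" using that by linarith
    then show ?thesis unfolding upt 
      by (elim disjE) (simp_all add: M_def pol_app_def opr_pointed_alg_cube[unfolded One_nat_def])
  qed
  moreover have "\<forall>i j c. M i j = CC c \<longrightarrow> c \<in> univ pointed_alg" by (simp add: M_def)
  moreover have "pwf pointed_alg 3 (PA 0 [PV 0, PV 1, PV 2])" by simp
  ultimately show ?thesis
    unfolding has_pointed_cube_poly_def
    by (intro exI[of _ 3] exI[of _ "PA 0 [PV 0, PV 1, PV 2]"] exI[of _ M]) auto
qed

text \<open>Tuples with exactly two entries 2 and all others 1 are irreducible: a value 1 needs all
  three arguments 1, a value 2 tolerates at most one deviating argument. Two coordinates spoil at
  most two of the three arguments, so one argument is the tuple itself.\<close>

lemma pointed_alg_not_linear: "\<not> d_linear pointed_alg"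
proof
  let ?A = pointed_alg
  have lower: "n choose 2 \<le> d_gen ?A n" for n
  proof -
    define \<P> where "\<P> = {P. P \<subseteq> {..<n} \<and> card P = 2}"
    define z where "z P = map (\<lambda>i. if i \<in> P then 2 else 1 :: nat) [0..<n]" for P
    have z_nth: "z P ! i = (if i \<in> P then 2 else 1)" if "i < n" for P i
      using that by (simp add: z_def)
    have "inj_on z \<P>"
    proof (rule inj_onI)
      fix P R assume PR: "P \<in> \<P>" "R \<in> \<P>" "z P = z R"
      have "i \<in> P \<longleftrightarrow> i \<in> R" if "i < n" for i
        using z_nth[OF that, of P] z_nth[OF that, of R] unfolding PR(3)
        by (cases "i \<in> P"; cases "i \<in> R"; simp)
      then show "P = R" using PR(1,2) unfolding \<P>_def by blast
    qed
    then have "card (z ` \<P>) = n choose 2"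
      using n_subsets[of "{..<n}" 2] by (simp add: card_image \<P>_def)
    moreover have "card (z ` \<P>) \<le> d_gen ?A n"
    proof (rule d_gen_ge_card_irreducible[OF fin_alg_pointed_alg])
      show "z ` \<P> \<subseteq> tuples (univ ?A) n" by (auto simp: z_def tuples_def)
      fix w f xs
      assume "w \<in> z ` \<P>" and "length xs = ar ?A f"
        and xs: "set xs \<subseteq> tuples (univ ?A) n" and eq: "opr (pow ?A n) f xs = w"
      then obtain P where P: "w = z P" "P \<in> \<P>" by blast
      obtain a b c where abc: "xs = [a, b, c]"
        using \<open>length xs = ar ?A f\<close> by (auto simp: length_3_conv)
      have len: "length a = n" "length b = n" "length c = n"
        using xs by (auto simp: abc tuples_def)
      have F: "w ! i = opr ?A f [a ! i, b ! i, c ! i]" if "i < n" for i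
        using that by (simp add: abc flip: eq del: pointed_alg_sel)
      have one: "a ! i = w ! i \<and> b ! i = w ! i \<and> c ! i = w ! i" if "i < n" "i \<notin> P" for i
        using opr_pointed_alg_eq_1[OF F[OF that(1), symmetric, THEN trans]]
          z_nth[OF that(1), of P] that(2) P(1) by simp
      have two: "(a ! i = w ! i \<and> b ! i = w ! i) \<or> (a ! i = w ! i \<and> c ! i = w ! i) \<or>
          (b ! i = w ! i \<and> c ! i = w ! i)" if "i < n" for i
        proof -
        have "w ! i = 1 \<or> w ! i = 2" using z_nth[OF that, of P] P(1) by simp
        then show ?thesis
          using opr_pointed_alg_eq_1[of f "a ! i" "b ! i" "c ! i"]
            opr_pointed_alg_eq_2[of f "a ! i" "b ! i" "c ! i"] F[OF that] by metis
      qed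
      obtain u v where uv: "P = {u, v}" "u < n" "v < n"
        using P(2) by (auto simp: \<P>_def card_2_iff)
      have "(\<forall>i<n. a ! i = w ! i) \<or> (\<forall>i<n. b ! i = w ! i) \<or> (\<forall>i<n. c ! i = w ! i)"
        using one two[OF uv(2)] two[OF uv(3)] unfolding uv(1) by blast
      moreover have "length w = n" by (simp add: P(1) z_def)
      ultimately have "a = w \<or> b = w \<or> c = w"
        using len by (metis nth_equalityI)
      then show "w \<in> set xs" by (auto simp: abc)
    qed
    ultimately show ?thesis by simp
  qed
  assume "d_linear ?A"
  then obtain C where "\<forall>\<^sub>F n in at_top. real (d_gen ?A n) \<le> C * real n"
    unfolding d_linear_def by (auto elim!: landau_o.bigE)
  moreover have "\<forall>\<^sub>F n in at_top. real n * (real n - 1) / 2 > C * real n"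
    by real_asymp
  ultimately have "\<forall>\<^sub>F n :: nat in at_top. False"
    using eventually_ge_at_top[of 1]
  proof eventually_elim
    case (elim n)
    have "even (n * (n - 1))" by (cases n) auto
    then have "2 * (n choose 2) = n * (n - 1)" by (simp add: choose_two)
    then have "2 * real (n choose 2) = real n * (real n - 1)"
      using elim(3) by (metis of_nat_1 of_nat_diff of_nat_mult of_nat_numeral)
    moreover have "real (n choose 2) \<le> real (d_gen ?A n)" using lower by simp
    ultimately show False using elim(1,2) by argo
  qed
  then show False by simp
qed

section \<open>(i), and hence (iv), without (iii): the two-element Boolean ring\<close>

definition boolean_ring :: "(nat, nat) alg" where
  "boolean_ring = \<lparr> univ = {0, 1}, sig = {0, 1}, ar = (\<lambda>f. if f = 0 then 3 else 2),
     opr = (\<lambda>f xs. if f = 0 then (xs ! 0 + xs ! 1 + xs ! 2) mod 2 else xs ! 0 * xs ! 1) \<rparr>"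

lemma boolean_ring_sel [simp]:
  "univ boolean_ring = {0, 1}" "sig boolean_ring = {0, 1}"
  "ar boolean_ring f = (if f = 0 then 3 else 2)"
  "opr boolean_ring f xs = (if f = 0 then (xs ! 0 + xs ! 1 + xs ! 2) mod 2 else xs ! 0 * xs ! 1)"
  by (simp_all add: boolean_ring_def)

lemma fin_alg_boolean_ring: "fin_alg boolean_ring"
  by (auto simp: fin_alg_def is_alg_def length_3_conv length_2_conv)

lemma boolean_ring_maltsev: "has_maltsev_poly boolean_ring"
  unfolding has_maltsev_poly_def
  by (rule exI[of _ "PA 0 [PV 0, PV 1, PV 2]"]) (auto simp: pol_app_def numeral_3_eq_3)

text \<open>Affine operations satisfy the term condition, multiplication does not.\<close>
lemma boolean_ring_no_type2: "type2_minimal_sets boolean_ring = {}"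
proof -
  have False if pq: "prime_quot boolean_ring \<alpha> \<beta>" and V: "min_set boolean_ring \<alpha> \<beta> V"
    and tr: "is_trace \<alpha> \<beta> V N" and t2: "trace_type2 boolean_ring \<alpha> N" for \<alpha> \<beta> V N
  proof -
    have con: "con boolean_ring \<alpha>" using pq by (simp add: prime_quot_def)
    then have eq: "equiv {0, 1 :: nat} \<alpha>" by (simp add: con_def)
    have "V \<subseteq> univ boolean_ring"
    proof -
      obtain p where "pwf boolean_ring 1 p" "V = (\<lambda>x. pol_app boolean_ring p [x]) ` univ boolean_ring"
        using V by (auto simp: min_set_def ms_cand_def)
      then show ?thesis
        using fin_alg_boolean_ring peval_closed[of boolean_ring 1]
        by (auto simp: pol_app_def fin_alg_def simp del: boolean_ring_sel)
    qed
    obtain b where "N = V \<inter> \<beta> `` {b}" using tr by (auto simp: is_trace_def)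
    obtain u w where uw: "u \<in> N" "w \<in> N" "(u, w) \<notin> \<alpha>" using tr by (auto simp: is_trace_def)
    have "u \<in> {0, 1}" "w \<in> {0, 1}" using uw \<open>N = _\<close> \<open>V \<subseteq> _\<close> by auto
    moreover have "u \<noteq> w" using uw eq calculation by (auto simp: equiv_def refl_on_def)
    \<comment> \<open>With two elements, a pair outside \<open>\<alpha>\<close> leaves no choice:
      the trace is everything and \<open>\<alpha>\<close> is equality.\<close>
    ultimately have N: "N = {0, 1}" and n01: "(0, 1) \<notin> \<alpha>" "(1, 0) \<notin> \<alpha>"
      using uw \<open>N = _\<close> \<open>V \<subseteq> _\<close> eq by (auto simp: equiv_def sym_def)
    define cls where "cls x = \<alpha> `` {x} \<inter> N" for x
    define Q where "Q = cls ` N"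
    have refl: "(0, 0) \<in> \<alpha>" "(1, 1) \<in> \<alpha>" using eq by (auto simp: equiv_def refl_on_def)
    have cls: "cls 0 = {0}" "cls 1 = {1}" using refl n01 by (auto simp: cls_def N)
    have Q: "Q = {{0}, {1}}" by (simp add: Q_def N cls[unfolded One_nat_def] cls)
    obtain K :: "nat ring" and W :: "(nat, nat set) module" where
      KW: "field K \<and> Module.module K W \<and> carrier W = Q \<and>
       (\<forall>n (g :: nat set list \<Rightarrow> nat set).
          (\<exists>p. pwf boolean_ring n p \<and> (\<forall>xs\<in>tuples N n. pol_app boolean_ring p xs \<in> N) \<and>
               (\<forall>xs\<in>tuples N n. g (map cls xs) = cls (pol_app boolean_ring p xs)))
          \<longleftrightarrow>
          (\<exists>ks c. length ks = n \<and> set ks \<subseteq> carrier K \<and> c \<in> Q \<and>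
               (\<forall>qs\<in>tuples Q n.
                  g qs = finsum W (\<lambda>i. (ks ! i) \<odot>\<^bsub>W\<^esub> (qs ! i)) {..<n} \<oplus>\<^bsub>W\<^esub> c)))"
      using t2 unfolding trace_type2_def Let_def cls_def[symmetric] Q_def[symmetric]
      by (elim exE) (rule that)
    then interpret W: Module.module K W by blast
    define g :: "nat set list \<Rightarrow> nat set" where
      "g qs = (if qs ! 0 = {1} \<and> qs ! 1 = {1} then {1} else {0})" for qs
    have ex: "\<exists>p. pwf boolean_ring 2 p \<and> (\<forall>xs\<in>tuples N 2. pol_app boolean_ring p xs \<in> N) \<and>
               (\<forall>xs\<in>tuples N 2. g (map cls xs) = cls (pol_app boolean_ring p xs))"
    proof (intro exI[of _ "PA 1 [PV 0, PV 1]"] conjI ballI)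
      fix xs assume xs: "xs \<in> tuples N 2"
      then obtain x y where xy: "xs = [x, y]" "x \<in> {0, 1}" "y \<in> {0, 1}"
        by (auto simp: tuples_def length_2_conv N)
      have mult: "pol_app boolean_ring (PA 1 [PV 0, PV 1]) xs = x * y"
        by (simp add: pol_app_def xy)
      show "pol_app boolean_ring (PA 1 [PV 0, PV 1]) xs \<in> N"
        unfolding mult using xy(2,3) by (auto simp: N)
      show "g (map cls xs) = cls (pol_app boolean_ring (PA 1 [PV 0, PV 1]) xs)"
        unfolding mult using xy(2,3)
        by (elim insertE emptyE) (simp_all add: g_def xy(1) cls cls[unfolded One_nat_def])
    qed auto
    obtain ks c where ks: "length ks = 2" "set ks \<subseteq> carrier K" "c \<in> Q"
      "\<And>qs. qs \<in> tuples Q 2 \<Longrightarrow>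
        g qs = finsum W (\<lambda>i. (ks ! i) \<odot>\<^bsub>W\<^esub> (qs ! i)) {..<2} \<oplus>\<^bsub>W\<^esub> c"
      using KW[THEN conjunct2, THEN conjunct2, THEN conjunct2, THEN spec, THEN spec, THEN iffD1, OF ex]
      by blast
    obtain k l where kl: "ks = [k, l]" "k \<in> carrier K" "l \<in> carrier K"
      using ks(1,2) by (auto simp: length_2_conv)
    have WQ: "carrier W = Q" using KW by blast
    have g2: "g [x, y] = (k \<odot>\<^bsub>W\<^esub> x \<oplus>\<^bsub>W\<^esub> l \<odot>\<^bsub>W\<^esub> y) \<oplus>\<^bsub>W\<^esub> c" if "x \<in> Q" "y \<in> Q" for x y
    proof -
      have "x \<in> carrier W" "y \<in> carrier W" using that WQ by simp_all
      moreover have "{..<2} = {0, 1 :: nat}" by auto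
      moreover have "[x, y] \<in> tuples Q 2" using that by (simp add: tuples_def)
      ultimately show ?thesis
        using ks(4)[of "[x, y]"] kl by simp
    qed
    \<comment> \<open>For an affine \<open>g\<close>, whether replacing \<open>y\<close> by
      \<open>y'\<close> changes the value cannot depend on \<open>x\<close>. Multiplication ignores
      \<open>y\<close> at \<open>x = {0}\<close> but not at \<open>x = {1}\<close>.\<close>
    have cancel: "l \<odot>\<^bsub>W\<^esub> y = l \<odot>\<^bsub>W\<^esub> y'"
      if "g [x, y] = g [x, y']" "x \<in> Q" "y \<in> Q" "y' \<in> Q" for x y y'
    proof -
      define r where "r = k \<odot>\<^bsub>W\<^esub> x"
      have mem: "r \<in> carrier W" "l \<odot>\<^bsub>W\<^esub> y \<in> carrier W" "l \<odot>\<^bsub>W\<^esub> y' \<in> carrier W" "c \<in> carrier W"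
        unfolding r_def using that kl ks(3) WQ by (auto intro!: W.smult_closed)
      have "(r \<oplus>\<^bsub>W\<^esub> l \<odot>\<^bsub>W\<^esub> y) \<oplus>\<^bsub>W\<^esub> c = (r \<oplus>\<^bsub>W\<^esub> l \<odot>\<^bsub>W\<^esub> y') \<oplus>\<^bsub>W\<^esub> c"
        using that by (simp add: g2 r_def)
      then show ?thesis
        using mem by (metis W.a_closed W.a_comm W.add.right_cancel)
    qed
    have "l \<odot>\<^bsub>W\<^esub> {0} = l \<odot>\<^bsub>W\<^esub> {1}" by (rule cancel[of "{0}"]) (auto simp: g_def Q)
    then have "g [{1}, {0}] = g [{1}, {1}]" using g2 by (simp add: Q)
    then show False by (simp add: g_def)
  qed
  then show ?thesis unfolding type2_minimal_sets_def typ2_def by blast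
qed

lemma boolean_ring_not_spread: "\<not> spread_of_type2 boolean_ring"
proof
  assume "spread_of_type2 boolean_ring"
  then obtain k p Us where "length Us = k" "set Us \<subseteq> {}" and
    eq: "univ boolean_ring = {pol_app boolean_ring p xs | xs. length xs = k \<and> (\<forall>i<k. xs ! i \<in> Us ! i)}"
    unfolding spread_of_type2_def spread_of_def boolean_ring_no_type2 by blast
  \<comment> \<open>There is no set to choose from, so \<open>Us\<close> is empty,
    \<open>k = 0\<close>, and the spread is a single value.\<close>
  then have "univ boolean_ring \<subseteq> {pol_app boolean_ring p []}" by auto
  then show False by auto
qed

section \<open>(iii), and hence (iv), without (ii): pairs over the two-element field\<close>

text \<open>Elements \<open>a + 2 * b\<close> code the pairs \<open>(a, b)\<close> over the two-element field; the operations
  are \<open>(a, b) + (a', b') = (a + a', 0)\<close> and the pairing \<open>(a, b), (a', b') \<mapsto> (a, a')\<close>.\<close>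
definition pairing_alg :: "(nat, nat) alg" where
  "pairing_alg = \<lparr> univ = {0, 1, 2, 3}, sig = {0, 1}, ar = (\<lambda>_. 2),
     opr = (\<lambda>f xs. if f = 0 then (xs ! 0 + xs ! 1) mod 2 else xs ! 0 mod 2 + 2 * (xs ! 1 mod 2)) \<rparr>"

lemma pairing_alg_sel [simp]:
  "univ pairing_alg = {0, 1, 2, 3}" "sig pairing_alg = {0, 1}" "ar pairing_alg f = 2"
  "opr pairing_alg f xs =
     (if f = 0 then (xs ! 0 + xs ! 1) mod 2 else xs ! 0 mod 2 + 2 * (xs ! 1 mod 2))"
  by (simp_all add: pairing_alg_def)

lemma univ_pairing_alg: "univ pairing_alg = {..<4}"
  by (auto simp: eval_nat_numeral less_Suc_eq)

lemma fin_alg_pairing_alg: "fin_alg pairing_alg"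
proof -
  have "opr pairing_alg f xs \<in> univ pairing_alg" for f xs
  proof -
    have "xs ! 0 mod 2 < 2" "xs ! 1 mod 2 < 2" "(xs ! 0 + xs ! 1) mod 2 < 2" by simp_all
    then have "xs ! 0 mod 2 + 2 * (xs ! 1 mod 2) < 4" "(xs ! 0 + xs ! 1) mod 2 < 4" by linarith+
    then show ?thesis by (simp add: univ_pairing_alg del: pairing_alg_sel(1))
  qed
  then show ?thesis by (simp add: fin_alg_def is_alg_def del: pairing_alg_sel(4))
qed

lemma pairing_alg_mod2:
  assumes "pwf pairing_alg m p" "\<And>i. i < m \<Longrightarrow> s i mod 2 = s' i mod 2"
  shows "peval pairing_alg s p mod 2 = peval pairing_alg s' p mod 2"
  using assms(1)
proof (induction p)
  case (PA f ts)
  then obtain t u where ts: "ts = [t, u]" by (auto simp: numeral_2_eq_2 length_Suc_conv)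
  have "peval pairing_alg s t mod 2 = peval pairing_alg s' t mod 2"
    "peval pairing_alg s u mod 2 = peval pairing_alg s' u mod 2"
    using PA by (auto simp: ts)
  then show ?case by (auto simp: ts intro: mod_add_cong)
qed (use assms in auto)

text \<open>An operation symbol only sees its arguments modulo 2, so a polynomial satisfying a cube
  identity would have to be a projection.\<close>
lemma pairing_alg_not_cube: "\<not> has_pointed_cube_poly pairing_alg"
proof
  let ?A = pairing_alg
  assume "has_pointed_cube_poly ?A"
  then obtain m k :: nat and p and M :: "nat \<Rightarrow> nat \<Rightarrow> nat cell"
    where cube: "1 \<le> m \<and> 1 \<le> k \<and> pwf ?A m p \<and>
     (\<forall>i<k. \<forall>j<m. \<forall>c. M i j = CC c \<longrightarrow> c \<in> univ ?A) \<and>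
     (\<forall>j<m. \<exists>i<k. M i j \<noteq> CV 0) \<and>
     (\<forall>s. (\<forall>v. s v \<in> univ ?A) \<longrightarrow>
        (\<forall>i<k. pol_app ?A p (map (\<lambda>j. cell_val s (M i j)) [0..<m]) = s 0))"
    unfolding has_pointed_cube_poly_def by blast
  have p: "pwf ?A m p" and "k \<ge> 1" using cube by blast+
  define row where "row s i j = map (\<lambda>j. cell_val s (M i j)) [0..<m] ! j" for s i j
  have row: "row s i j = cell_val s (M i j)" if "j < m" for s i j
    using that by (simp add: row_def)
  have id: "peval ?A (row s i) p = s 0" if "\<And>v. s v \<in> univ ?A" "i < k" for s i
  proof -
    have "pol_app ?A p (map (\<lambda>j. cell_val s (M i j)) [0..<m]) = s 0" using cube that by blast
    then show ?thesis by (simp add: pol_app_def row_def[abs_def])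
  qed
  show False
  proof (cases p)
    case (PV j)
    then have "j < m" using p by simp
    then obtain i where i: "i < k" "M i j \<noteq> CV 0" using cube by blast
    have cell: "cell_val s (M i j) = s 0" if "\<And>v. s v \<in> univ ?A" for s
      using id[OF that i(1)] row[OF \<open>j < m\<close>] by (simp add: PV)
    show False
    proof (cases "M i j")
      case (CV v)
      then have "v \<noteq> 0" using i(2) by simp
      \<comment> \<open>An assignment under which x differs from every other variable.\<close>
      moreover define s where "s = (\<lambda>_ :: nat. 0 :: nat)(0 := 1)"
      moreover have "cell_val s (M i j) = s 0"
        by (rule cell) (simp add: s_def)
      ultimately show False by (simp add: CV)
    next
      case (CC c)
      then show False using cell[of "\<lambda>_. 0"] cell[of "\<lambda>_. 1"] by simp
    qed
  next
    case (PC c)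
    then show False using id[of "\<lambda>_. 0" 0] id[of "\<lambda>_. 1" 0] \<open>k \<ge> 1\<close> by simp
  next
    case (PA f ts)
    define s where "s = (\<lambda>_::nat. 0 :: nat)"
    \<comment> \<open>Changing x from 0 to 2 keeps its parity, so the outermost operation of
      \<open>p\<close> cannot notice, although the cube identity demands a different value.\<close>
    define s' where "s' = s(0 := 2)"
    obtain t u where ts: "ts = [t, u]"
      using p by (auto simp: PA numeral_2_eq_2 length_Suc_conv)
    have wf: "pwf ?A m t" "pwf ?A m u" using p by (auto simp: PA ts)
    have "row s 0 j mod 2 = row s' 0 j mod 2" if "j < m" for j
      unfolding row[OF that] by (cases "M 0 j") (auto simp: s_def s'_def)
    then have "peval ?A (row s 0) t mod 2 = peval ?A (row s' 0) t mod 2"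
      "peval ?A (row s 0) u mod 2 = peval ?A (row s' 0) u mod 2"
      using pairing_alg_mod2 wf by blast+
    then have "peval ?A (row s 0) p = peval ?A (row s' 0) p"
      by (auto simp: PA ts intro: mod_add_cong)
    moreover have "s v \<in> univ ?A" "s' v \<in> univ ?A" for v by (simp_all add: s_def s'_def)
    ultimately have "s 0 = s' 0" using id[of s 0] id[of s' 0] \<open>k \<ge> 1\<close> by simp
    then show False by (simp add: s_def s'_def)
  qed
qed

definition gf2 :: "nat ring" where
  "gf2 = \<lparr> carrier = {0, 1}, mult = (*), one = 1, zero = 0, add = (\<lambda>x y. (x + y) mod 2) \<rparr>"

text \<open>The one-dimensional space over the two-element field, carried by singletons because
  \<open>trace_type2\<close> puts the module on the \<alpha>-classes inside the trace.\<close>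

definition gf2_line :: "(nat, nat set) module" where
  "gf2_line = \<lparr> carrier = {{0}, {1}}, mult = (\<lambda>X Y. X), one = {1}, zero = {0},
     add = (\<lambda>X Y. {(the_elem X + the_elem Y) mod 2}), smult = (\<lambda>k X. {k * the_elem X}) \<rparr>"

lemma gf2_sel [simp]:
  "carrier gf2 = {0, 1}" "x \<otimes>\<^bsub>gf2\<^esub> y = x * y" "\<one>\<^bsub>gf2\<^esub> = 1" "\<zero>\<^bsub>gf2\<^esub> = 0"
  "x \<oplus>\<^bsub>gf2\<^esub> y = (x + y) mod 2"
  by (simp_all add: gf2_def)

lemma gf2_line_sel [simp]:
  "carrier gf2_line = {{0}, {1}}" "\<zero>\<^bsub>gf2_line\<^esub> = {0}"
  "X \<oplus>\<^bsub>gf2_line\<^esub> Y = {(the_elem X + the_elem Y) mod 2}" "k \<odot>\<^bsub>gf2_line\<^esub> X = {k * the_elem X}"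
  by (simp_all add: gf2_line_def)

lemma field_gf2: "field gf2"
proof -
  have "abelian_group gf2"
    by (rule abelian_groupI) (auto simp: mod_simps)
  moreover have "comm_monoid gf2"
    by (rule comm_monoidI) auto
  ultimately have "cring gf2"
    by (rule cringI) auto
  moreover have "Units gf2 = carrier gf2 - {\<zero>\<^bsub>gf2\<^esub>}"
    by (auto simp: Units_def)
  ultimately show ?thesis by (rule cring.cring_fieldI)
qed

lemma module_gf2_line: "Module.module gf2 gf2_line"
proof (rule moduleI)
  show "cring gf2" using field_gf2 by (simp add: field_def domain_def)
  show "abelian_group gf2_line"
    by (rule abelian_groupI) auto
qed auto

lemma finsum_gf2_line:
  fixes n :: nat
  assumes "\<And>i. i < n \<Longrightarrow> f i \<in> {{0}, {1}}"
  shows "finsum gf2_line f {..<n} = {(\<Sum>i<n. the_elem (f i)) mod 2}"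
proof -
  interpret Module.module gf2 gf2_line by (rule module_gf2_line)
  show ?thesis
    using assms
  proof (induction n)
    case (Suc n)
    have "finsum gf2_line f (insert n {..<n}) = f n \<oplus>\<^bsub>gf2_line\<^esub> finsum gf2_line f {..<n}"
      using Suc.prems by (intro finsum_insert) (auto simp: Pi_iff)
    then show ?case
      using Suc by (simp add: lessThan_Suc mod_simps add.commute)
  qed simp
qed

text \<open>Modulo 2 the first operation is addition and the second is the projection to its first
  argument, so parities of polynomials stay affine.\<close>

lemma pairing_alg_affine:
  assumes "pwf pairing_alg n p"
  shows "\<exists>\<kappa> c. (\<forall>i. \<kappa> i \<in> {0, 1 :: nat}) \<and> c \<in> {0, 1} \<and>
    (\<forall>s. peval pairing_alg s p mod 2 = ((\<Sum>i<n. \<kappa> i * s i) + c) mod 2)"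
  using assms
proof (induction p)
  case (PV j)
  have "(\<Sum>i<n. (if i = j then 1 else 0) * s i) = s j" for s :: "nat \<Rightarrow> nat"
  proof -
    have "(\<Sum>i<n. (if i = j then 1 else 0) * s i) = (\<Sum>i<n. if i = j then s i else 0)"
      by (intro sum.cong) auto
    then show ?thesis using PV by simp
  qed
  then show ?case
    by (intro exI[of _ "\<lambda>i. if i = j then 1 else 0"] exI[of _ 0]) simp
next
  case (PC c)
  show ?case by (intro exI[of _ "\<lambda>_. 0"] exI[of _ "c mod 2"]) auto
next
  case (PA f ts)
  then obtain t u where ts: "ts = [t, u]" by (auto simp: numeral_2_eq_2 length_Suc_conv)
  have wf: "t \<in> set ts" "pwf pairing_alg n t" "u \<in> set ts" "pwf pairing_alg n u"
    using PA.prems by (simp_all add: ts)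
  obtain \<kappa> c where t: "(\<forall>i. \<kappa> i \<in> {0, 1 :: nat}) \<and> c \<in> {0, 1} \<and>
      (\<forall>s. peval pairing_alg s t mod 2 = ((\<Sum>i<n. \<kappa> i * s i) + c) mod 2)"
    using PA.IH[OF wf(1,2)] by (elim exE) (rule that)
  obtain \<mu> d where u: "(\<forall>i. \<mu> i \<in> {0, 1 :: nat}) \<and> d \<in> {0, 1} \<and>
      (\<forall>s. peval pairing_alg s u mod 2 = ((\<Sum>i<n. \<mu> i * s i) + d) mod 2)"
    using PA.IH[OF wf(3,4)] by (elim exE) (rule that)
  show ?case
  proof (cases "f = 0")
    case True
    have "peval pairing_alg s (PA f ts) mod 2 =
        ((\<Sum>i<n. ((\<kappa> i + \<mu> i) mod 2) * s i) + (c + d) mod 2) mod 2" for s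
    proof -
      have "(\<Sum>i<n. ((\<kappa> i + \<mu> i) mod 2) * s i) mod 2 = (\<Sum>i<n. (\<kappa> i + \<mu> i) * s i) mod 2"
        by (subst (1 2) mod_sum_eq[symmetric]) (simp add: mod_simps)
      then have "((\<Sum>i<n. ((\<kappa> i + \<mu> i) mod 2) * s i) + (c + d) mod 2) mod 2 =
          ((\<Sum>i<n. (\<kappa> i + \<mu> i) * s i) + (c + d)) mod 2"
        unfolding mod_add_right_eq by (rule mod_add_cong) simp
      also have "\<dots> = (((\<Sum>i<n. \<kappa> i * s i) + c) + ((\<Sum>i<n. \<mu> i * s i) + d)) mod 2"
        by (simp add: algebra_simps sum.distrib)
      also have "\<dots> = (peval pairing_alg s t + peval pairing_alg s u) mod 2"
        by (rule mod_add_cong) (use t u in simp_all)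
      finally show ?thesis by (simp add: True ts)
    qed
    then show ?thesis
      by (intro exI[of _ "\<lambda>i. (\<kappa> i + \<mu> i) mod 2"] exI[of _ "(c + d) mod 2"]) auto
  next
    case False
    then have "peval pairing_alg s (PA f ts) mod 2 = peval pairing_alg s t mod 2" for s
      by (simp add: ts)
    then show ?thesis using t by (intro exI[of _ \<kappa>] exI[of _ c]) simp
  qed
qed

text \<open>The converse of the affine description: every affine form with coefficients 0 and 1 is
  written out by iterated addition.\<close>

primrec affine_poly :: "nat list \<Rightarrow> nat \<Rightarrow> nat \<Rightarrow> (nat, nat) ptrm" where
  "affine_poly ks c 0 = PC c"
| "affine_poly ks c (Suc n) = PA 0 [affine_poly ks c n, if ks ! n = 1 then PV n else PC 0]"

lemma pwf_affine_poly: "c \<in> {0, 1} \<Longrightarrow> n \<le> m \<Longrightarrow> pwf pairing_alg m (affine_poly ks c n)"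
  by (induction n) auto

lemma peval_affine_poly:
  assumes "c \<in> {0, 1}" "\<And>i. i < n \<Longrightarrow> ks ! i \<in> {0, 1}"
  shows "peval pairing_alg s (affine_poly ks c n) = ((\<Sum>i<n. ks ! i * s i) + c) mod 2"
  using assms(2)
proof (induction n)
  case (Suc n)
  have "peval pairing_alg s (if ks ! n = 1 then PV n else PC 0) = ks ! n * s n"
    using Suc.prems[of n] by auto
  then show ?case using Suc by (simp add: mod_simps algebra_simps del: peval.simps(1,2))
qed (use assms(1) in auto)

text \<open>The quotient is equal parity below the full relation. Adding 0 reduces modulo 2 and so
  maps the algebra onto \<open>{0, 1}\<close>, where \<open>\<alpha>\<close> is equality; the
  polynomials act there exactly as the affine maps over the two-element field.\<close>

lemma pairing_alg_type2: "{0, 1} \<in> type2_minimal_sets pairing_alg"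
proof -
  let ?A = pairing_alg and ?N = "{0, 1 :: nat}"
  let ?U = "univ ?A"
  define \<alpha> where "\<alpha> = {(x, y). x \<in> ?U \<and> y \<in> ?U \<and> x mod 2 = y mod 2}"
  define \<beta> where "\<beta> = ?U \<times> ?U"
  have opr_in: "opr ?A f xs \<in> ?U" if "f \<in> sig ?A" "length xs = ar ?A f" "set xs \<subseteq> ?U" for f xs
    using fin_alg_pairing_alg that unfolding fin_alg_def is_alg_def by blast
  have "con ?A \<beta>"
    unfolding con_def
  proof (intro conjI ballI allI impI)
    show "equiv ?U \<beta>"
      unfolding \<beta>_def by (rule equivI) (auto simp: refl_on_def sym_def trans_def)
    fix f xs ys assume f: "f \<in> sig ?A" and *: "length xs = ar ?A f \<and> length ys = ar ?A f \<and>
      list_all2 (\<lambda>x y. (x, y) \<in> \<beta>) xs ys"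
    then have "set xs \<subseteq> ?U" "set ys \<subseteq> ?U"
      by (auto simp: list_all2_conv_all_nth in_set_conv_nth \<beta>_def simp del: pairing_alg_sel)
    then show "(opr ?A f xs, opr ?A f ys) \<in> \<beta>" using opr_in f * unfolding \<beta>_def by blast
  qed
  moreover have con_\<alpha>: "con ?A \<alpha>"
    unfolding con_def
  proof (intro conjI ballI allI impI)
    show "equiv ?U \<alpha>"
      unfolding \<alpha>_def by (rule equivI) (auto simp: refl_on_def sym_def trans_def)
    fix f xs ys assume f: "f \<in> sig ?A" and *: "length xs = ar ?A f \<and> length ys = ar ?A f \<and>
      list_all2 (\<lambda>x y. (x, y) \<in> \<alpha>) xs ys"
    then have nth: "(xs ! i, ys ! i) \<in> \<alpha>" if "i < 2" for i
      using that by (auto simp: list_all2_conv_all_nth)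
    have "set xs \<subseteq> ?U" "set ys \<subseteq> ?U"
      using * by (auto simp: list_all2_conv_all_nth in_set_conv_nth \<alpha>_def simp del: pairing_alg_sel)
    then have "opr ?A f xs \<in> ?U" "opr ?A f ys \<in> ?U" using opr_in f * by blast+
    moreover have "opr ?A f xs mod 2 = opr ?A f ys mod 2"
      using nth[of 0] nth[of 1] unfolding \<alpha>_def pairing_alg_sel(4)
      by (auto intro: mod_add_cong simp del: pairing_alg_sel)
    ultimately show "(opr ?A f xs, opr ?A f ys) \<in> \<alpha>" by (simp add: \<alpha>_def del: pairing_alg_sel)
  qed
  moreover have "\<alpha> \<subset> \<beta>"
  proof
    show "\<alpha> \<subseteq> \<beta>" by (auto simp: \<alpha>_def \<beta>_def)
    have "(0, 1) \<in> \<beta>" "(0, 1) \<notin> \<alpha>" by (auto simp: \<alpha>_def \<beta>_def)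
    then show "\<alpha> \<noteq> \<beta>" by blast
  qed
  moreover have "\<not> (\<alpha> \<subset> \<gamma> \<and> \<gamma> \<subset> \<beta>)" if \<gamma>: "con ?A \<gamma>" for \<gamma>
  proof
    assume *: "\<alpha> \<subset> \<gamma> \<and> \<gamma> \<subset> \<beta>"
    have "\<alpha> \<subset> \<gamma>" using * by (rule conjunct1)
    then obtain z where z: "z \<in> \<gamma>" "z \<notin> \<alpha>" by (meson psubset_imp_ex_mem DiffD1 DiffD2)
    obtain x y where "z = (x, y)" by (cases z)
    with z have xy: "(x, y) \<in> \<gamma>" "(x, y) \<notin> \<alpha>" by simp_all
    have "\<gamma> \<subseteq> \<beta>" using * by blast
    then have U: "x \<in> ?U" "y \<in> ?U" using xy(1) unfolding \<beta>_def by blast+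
    then have U: "x \<in> ?U" "y \<in> ?U" "x mod 2 \<noteq> y mod 2" using xy(2) unfolding \<alpha>_def by blast+
    have "equiv ?U \<gamma>" using \<gamma> by (simp add: con_def)
    then have sym: "sym \<gamma>" and trans: "trans \<gamma>" by (auto simp: equiv_def)
    have "(u, v) \<in> \<gamma>" if "u \<in> ?U" "v \<in> ?U" for u v
    proof -
      \<comment> \<open>Parity has only two classes, so every \<open>w\<close> is
        \<open>\<alpha>\<close>-related to \<open>x\<close> or to \<open>y\<close>, and
        \<open>\<gamma>\<close> already joins these two.\<close>
      have near: "(w, x) \<in> \<gamma>" if "w \<in> ?U" for w
      proof -
        have "w mod 2 = x mod 2 \<or> w mod 2 = y mod 2" using U(3) by linarith
        then have "(w, x) \<in> \<alpha> \<or> (w, y) \<in> \<alpha>" using that U by (auto simp: \<alpha>_def)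
        then show ?thesis using * xy sym trans by (meson psubsetD symD transD)
      qed
      then show ?thesis using that sym trans by (meson symD transD)
    qed
    then show False using * by (auto simp: \<beta>_def)
  qed
  ultimately have prime: "prime_quot ?A \<alpha> \<beta>" unfolding prime_quot_def by blast
  have cand: "ms_cand ?A \<alpha> \<beta> ?N"
    unfolding ms_cand_def
  proof (intro exI[of _ "PA 0 [PV 0, PC 0]"] conjI)
    show "?N = (\<lambda>x. pol_app ?A (PA 0 [PV 0, PC 0]) [x]) ` ?U"
      by (auto simp: pol_app_def)
    show "\<exists>(a, b)\<in>\<beta>. (pol_app ?A (PA 0 [PV 0, PC 0]) [a], pol_app ?A (PA 0 [PV 0, PC 0]) [b]) \<notin> \<alpha>"
      by (intro bexI[of _ "(0, 1)"]) (auto simp: pol_app_def \<alpha>_def \<beta>_def)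
  qed simp
  have "\<not> W \<subset> ?N" if W: "ms_cand ?A \<alpha> \<beta> W" for W
  proof
    assume "W \<subset> ?N"
    obtain p a b where p: "W = (\<lambda>x. pol_app ?A p [x]) ` ?U" "(a, b) \<in> \<beta>"
      "(pol_app ?A p [a], pol_app ?A p [b]) \<notin> \<alpha>"
      using W unfolding ms_cand_def by blast
    then have ab: "pol_app ?A p [a] \<in> W" "pol_app ?A p [b] \<in> W" by (auto simp: \<beta>_def)
    have "(w, w) \<in> \<alpha>" if "w \<in> W" for w
    proof -
      have "w \<in> ?N" using that \<open>W \<subset> ?N\<close> by blast
      then show ?thesis by (auto simp: \<alpha>_def)
    qed
    from this[OF ab(1)] have "pol_app ?A p [a] \<noteq> pol_app ?A p [b]" using p(3) by metis
    moreover have "W = {0} \<or> W = {1} \<or> W = {}" using \<open>W \<subset> ?N\<close> by blast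
    ultimately show False using ab by (metis singletonD empty_iff)
  qed
  with cand have min: "min_set ?A \<alpha> \<beta> ?N" unfolding min_set_def by blast
  have trace: "is_trace \<alpha> \<beta> ?N ?N"
    unfolding is_trace_def
    by (intro conjI bexI[of _ 0] bexI[of _ 1]) (auto simp: \<alpha>_def \<beta>_def)
  define cls where "cls x = \<alpha> `` {x} \<inter> ?N" for x
  have cls: "cls x = {x}" if "x \<in> ?N" for x using that by (auto simp: cls_def \<alpha>_def)
  then have Q: "cls ` ?N = {{0}, {1}}" by auto
  have "trace_type2 ?A \<alpha> ?N"
    unfolding trace_type2_def Let_def cls_def[symmetric] Q
  proof (intro exI[of _ gf2] exI[of _ gf2_line] conjI allI)
    fix n and g :: "nat set list \<Rightarrow> nat set"
    let ?Q = "{{0}, {1 :: nat}}"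
    have tup: "map the_elem qs \<in> tuples ?N n \<and> map cls (map the_elem qs) = qs" if "qs \<in> tuples ?Q n" for qs
    proof -
      have "\<forall>q\<in>set qs. the_elem q \<in> ?N \<and> cls (the_elem q) = q"
        using that cls by (auto simp: tuples_def)
      then show ?thesis using that by (auto simp: tuples_def intro: map_idI)
    qed
    have sum: "finsum gf2_line (\<lambda>i. ks ! i \<odot>\<^bsub>gf2_line\<^esub> qs ! i) {..<n} \<oplus>\<^bsub>gf2_line\<^esub> {c} =
        {((\<Sum>i<n. ks ! i * the_elem (qs ! i)) + c) mod 2}"
      if "length ks = n" "set ks \<subseteq> {0, 1}" "qs \<in> tuples ?Q n" for ks qs c
    proof -
      have "ks ! i * the_elem (qs ! i) \<in> {0, 1}" if "i < n" for i
      proof -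
        have "ks ! i \<in> {0, 1}" using \<open>set ks \<subseteq> {0, 1}\<close> \<open>length ks = n\<close> that nth_mem by blast
        moreover have "qs ! i \<in> ?Q" using \<open>qs \<in> _\<close> that by (simp add: tuples_iff)
        ultimately show ?thesis by (elim insertE emptyE) simp_all
      qed
      then have "finsum gf2_line (\<lambda>i. ks ! i \<odot>\<^bsub>gf2_line\<^esub> qs ! i) {..<n} =
          {(\<Sum>i<n. the_elem (ks ! i \<odot>\<^bsub>gf2_line\<^esub> qs ! i)) mod 2}"
        by (intro finsum_gf2_line) auto
      then show ?thesis by (simp add: mod_simps)
    qed
    show "(\<exists>p. pwf ?A n p \<and> (\<forall>xs\<in>tuples ?N n. pol_app ?A p xs \<in> ?N) \<and>
        (\<forall>xs\<in>tuples ?N n. g (map cls xs) = cls (pol_app ?A p xs))) \<longleftrightarrow>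
      (\<exists>ks c. length ks = n \<and> set ks \<subseteq> carrier gf2 \<and> c \<in> ?Q \<and>
        (\<forall>qs\<in>tuples ?Q n. g qs = finsum gf2_line (\<lambda>i. ks ! i \<odot>\<^bsub>gf2_line\<^esub> qs ! i) {..<n}
          \<oplus>\<^bsub>gf2_line\<^esub> c))" (is "?L \<longleftrightarrow> ?R")
    proof
      assume ?L
      then obtain p where p: "pwf ?A n p" "\<And>xs. xs \<in> tuples ?N n \<Longrightarrow> pol_app ?A p xs \<in> ?N"
        "\<And>xs. xs \<in> tuples ?N n \<Longrightarrow> g (map cls xs) = cls (pol_app ?A p xs)" by blast
      obtain \<kappa> c where \<kappa>: "\<forall>i. \<kappa> i \<in> {0, 1 :: nat}" "c \<in> {0, 1}"
        "\<And>s. peval ?A s p mod 2 = ((\<Sum>i<n. \<kappa> i * s i) + c) mod 2"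
        using pairing_alg_affine[OF p(1)] by blast
      define ks where "ks = map \<kappa> [0..<n]"
      have ks: "length ks = n" "set ks \<subseteq> {0, 1}" using \<kappa>(1) unfolding ks_def by (simp, force)
      have "g qs = finsum gf2_line (\<lambda>i. ks ! i \<odot>\<^bsub>gf2_line\<^esub> qs ! i) {..<n} \<oplus>\<^bsub>gf2_line\<^esub> {c}"
        if qs: "qs \<in> tuples ?Q n" for qs
      proof -
        define xs where "xs = map the_elem qs"
        have xs: "xs \<in> tuples ?N n" "map cls xs = qs" using tup[OF qs] by (auto simp: xs_def)
        \<comment> \<open>Values in the trace are 0 or 1, hence determined by their parity, for
          which the affine form is known.\<close>
        have "pol_app ?A p xs = pol_app ?A p xs mod 2" using p(2)[OF xs(1)] by auto
        also have "\<dots> = ((\<Sum>i<n. \<kappa> i * xs ! i) + c) mod 2"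
          unfolding pol_app_def by (rule \<kappa>(3))
        also have "(\<Sum>i<n. \<kappa> i * xs ! i) = (\<Sum>i<n. ks ! i * the_elem (qs ! i))"
          using qs by (intro sum.cong) (auto simp: ks_def xs_def tuples_def)
        finally have "pol_app ?A p xs = ((\<Sum>i<n. ks ! i * the_elem (qs ! i)) + c) mod 2" .
        then show ?thesis
          using p(3)[OF xs(1)] xs(2) cls[OF p(2)[OF xs(1)]] sum[OF ks qs] by simp
      qed
      then show ?R using ks \<kappa>(2) by (intro exI[of _ ks] exI[of _ "{c}"]) auto
    next
      assume ?R
      then obtain ks C where ks: "length ks = n" "set ks \<subseteq> {0, 1}" and "C \<in> ?Q" and
        g: "\<And>qs. qs \<in> tuples ?Q n \<Longrightarrow>
          g qs = finsum gf2_line (\<lambda>i. ks ! i \<odot>\<^bsub>gf2_line\<^esub> qs ! i) {..<n} \<oplus>\<^bsub>gf2_line\<^esub> C"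
        unfolding gf2_sel(1) by blast
      then obtain c where c: "C = {c}" "c \<in> {0, 1}" by blast
      have nth: "ks ! i \<in> {0, 1}" if "i < n" for i using ks that nth_mem by blast
      define p where "p = affine_poly ks c n"
      have pwf: "pwf ?A n p" unfolding p_def by (rule pwf_affine_poly[OF c(2)]) simp
      have pv: "pol_app ?A p xs = ((\<Sum>i<n. ks ! i * xs ! i) + c) mod 2" for xs
        unfolding pol_app_def p_def by (rule peval_affine_poly[OF c(2) nth])
      then have pN: "pol_app ?A p xs \<in> ?N" for xs by auto
      moreover have "g (map cls xs) = cls (pol_app ?A p xs)" if xs: "xs \<in> tuples ?N n" for xs
      proof -
        have "cls (xs ! i) = {xs ! i}" if "i < n" for i using xs that cls by (simp add: tuples_iff)
        moreover have "map cls xs \<in> tuples ?Q n"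
          unfolding tuples_iff
        proof (intro conjI allI impI)
          show "length (map cls xs) = n" using xs by (simp add: tuples_def)
          fix i assume "i < n"
          then have "xs ! i \<in> ?N" "map cls xs ! i = cls (xs ! i)"
            using xs by (simp_all only: tuples_iff nth_map)
          then show "map cls xs ! i \<in> ?Q" unfolding Q[symmetric] by (metis imageI)
        qed
        ultimately show ?thesis
          using g[of "map cls xs"] sum[OF ks, of "map cls xs" c] xs cls[OF pN] pv
          by (simp add: c(1) tuples_def)
      qed
      ultimately show ?L using pwf by blast
    qed
  qed (use field_gf2 module_gf2_line in auto)
  with prime min trace show ?thesis
    unfolding type2_minimal_sets_def typ2_def by blast
qed

text \<open>The pairing operation rebuilds each element from its two bits \<open>x mod 2\<close> and
  \<open>x div 2\<close>, both ranging over the minimal set \<open>{0, 1}\<close>.\<close>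

lemma pairing_alg_spread: "spread_of_type2 pairing_alg"
  unfolding spread_of_type2_def spread_of_def
proof (intro exI conjI)
  show "pwf pairing_alg 2 (PA 1 [PV 0, PV 1])" by simp
  show "set [{0, 1}, {0, 1}] \<subseteq> type2_minimal_sets pairing_alg" using pairing_alg_type2 by simp
  have "\<exists>xs. x = pol_app pairing_alg (PA 1 [PV 0, PV 1]) xs \<and> length xs = 2 \<and>
      (\<forall>i<2. xs ! i \<in> [{0, 1}, {0, 1}] ! i)" if "x \<in> univ pairing_alg" for x
    using that by (intro exI[of _ "[x mod 2, x div 2]"])
      (auto simp: pol_app_def less_2_cases_iff)
  moreover have "pol_app pairing_alg (PA 1 [PV 0, PV 1]) xs \<in> univ pairing_alg"
    if "xs ! 0 \<in> {0, 1}" "xs ! 1 \<in> {0, 1}" for xs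
    using that by (auto simp: pol_app_def)
  ultimately show "univ pairing_alg = {pol_app pairing_alg (PA 1 [PV 0, PV 1]) xs |xs.
      length xs = 2 \<and> (\<forall>i<2. xs ! i \<in> [{0, 1}, {0, 1}] ! i)}"
    by (auto simp: less_2_cases_iff simp del: pairing_alg_sel)
qed simp

theorem theorem2p12:
  shows "(\<forall>A :: ('a, 'f) alg. fin_alg A \<longrightarrow>
            (has_maltsev_poly A \<longrightarrow> d_linear A) \<and>
            (has_maltsev_poly A \<longrightarrow> has_pointed_cube_poly A) \<and>
            (has_pointed_cube_poly A \<longrightarrow> d_not_exp A) \<and>
            (spread_of_type2 A \<longrightarrow> d_linear A) \<and>
            (d_linear A \<longrightarrow> d_not_exp A) \<and>
            (d_not_exp A \<longrightarrow> no_sa_image A))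
       \<and> (\<exists>A :: (nat, nat) alg. fin_alg A \<and> no_sa_image A \<and> \<not> d_not_exp A)
       \<and> (\<exists>A :: (nat, nat) alg. fin_alg A \<and> d_not_exp A \<and> \<not> d_linear A)
       \<and> (\<exists>A :: (nat, nat) alg. fin_alg A \<and> d_linear A \<and> \<not> spread_of_type2 A)
       \<and> (\<exists>A :: (nat, nat) alg. fin_alg A \<and> spread_of_type2 A \<and> \<not> has_pointed_cube_poly A)
       \<and> (\<exists>A :: (nat, nat) alg. fin_alg A \<and> has_pointed_cube_poly A \<and> \<not> d_linear A)
       \<and> (\<exists>A :: (nat, nat) alg. fin_alg A \<and> d_linear A \<and> \<not> has_pointed_cube_poly A)
       \<and> (\<exists>A :: (nat, nat) alg. fin_alg A \<and> has_maltsev_poly A \<and> \<not> spread_of_type2 A)"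
proof (intro conjI allI impI)
  fix A :: "('a, 'f) alg" assume fin: "fin_alg A"
  show "has_maltsev_poly A \<Longrightarrow> d_linear A" by (rule maltsev_imp_d_linear[OF fin])
  show "has_maltsev_poly A \<Longrightarrow> has_pointed_cube_poly A" by (rule maltsev_imp_cube)
  show "has_pointed_cube_poly A \<Longrightarrow> d_not_exp A" by (rule cube_imp_d_not_exp[OF fin])
  show "spread_of_type2 A \<Longrightarrow> d_linear A" by (rule spread_of_type2_imp_d_linear[OF fin])
  show "d_linear A \<Longrightarrow> d_not_exp A" by (rule d_linear_imp_d_not_exp)
  show "d_not_exp A \<Longrightarrow> no_sa_image A" by (rule d_not_exp_imp_no_sa_image[OF fin])
next
  show "\<exists>A :: (nat, nat) alg. fin_alg A \<and> no_sa_image A \<and> \<not> d_not_exp A"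
    using fin_alg_flat_semilattice flat_semilattice_no_sa_image flat_semilattice_exp by blast
  show "\<exists>A :: (nat, nat) alg. fin_alg A \<and> d_not_exp A \<and> \<not> d_linear A"
    using fin_alg_pointed_alg cube_imp_d_not_exp pointed_alg_cube pointed_alg_not_linear by blast
  show "\<exists>A :: (nat, nat) alg. fin_alg A \<and> has_pointed_cube_poly A \<and> \<not> d_linear A"
    using fin_alg_pointed_alg pointed_alg_cube pointed_alg_not_linear by blast
  show "\<exists>A :: (nat, nat) alg. fin_alg A \<and> d_linear A \<and> \<not> spread_of_type2 A"
    using fin_alg_boolean_ring maltsev_imp_d_linear boolean_ring_maltsev boolean_ring_not_spread
    by blast
  show "\<exists>A :: (nat, nat) alg. fin_alg A \<and> has_maltsev_poly A \<and> \<not> spread_of_type2 A"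
    using fin_alg_boolean_ring boolean_ring_maltsev boolean_ring_not_spread by blast
  show "\<exists>A :: (nat, nat) alg. fin_alg A \<and> spread_of_type2 A \<and> \<not> has_pointed_cube_poly A"
    using fin_alg_pairing_alg pairing_alg_spread pairing_alg_not_cube by blast
  show "\<exists>A :: (nat, nat) alg. fin_alg A \<and> d_linear A \<and> \<not> has_pointed_cube_poly A"
    using fin_alg_pairing_alg spread_of_type2_imp_d_linear pairing_alg_spread pairing_alg_not_cube
    by blast
qed

end
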